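(* Let $\Gamma=\{g_1,g_2,\ldots,g_k\}\subset H^+$ be admissible. Then for any probability distribution $p=(p_1,\ldots,p_k)$ on $\Gamma$ with all $p_i>0$, the operator $P$ corresponding to $(\Gamma,p)$ admits a unique invariant measure in the set of Borel probability measures on $\mathbf{S}^1$.
   Context: $\mathbf{S}^1$ is the circle with arc length normalized to total length $1$. $H^+$ is the set of orientation preserving homeomorphisms of $\mathbf{S}^1$. $\mathcal{M}_{fin}$ is the set of finite Borel measures on $\mathbf{S}^1$. $\Gamma=\{g_1,\ldots,g_k\}\subset H^+$ is a finite collection and $p(g_i)=p_i>0$, $\sum_i p_i=1$. The Markov operator corresponding to $(\Gamma,p)$ is $P:\mathcal{M}_{fin}\to\mathcal{M}_{fin}$, $P\mu=\sum_{i=1}^k p_i\,\mu\circ g_i^{-1}$, where $(\mu\circ g^{-1})(A)=\mu(g^{-1}(A))$ for Borel $A$. A measure $\mu_*$ is invariant if $P\mu_*=\mu_*$. $\Gamma$ is admissible if one of its elements, labelled $g_1$, is such that $\{g_1^n(x):n\ge1\}$ is dense in $\mathbf{S}^1$ for some (and thus all) $x\in\mathbf{S}^1$. *)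

theory Defs
  imports "HOL-Probability.Probability"
begin

abbreviation circle :: "complex set" where
  "circle \<equiv> sphere 0 1"

(* The covering map of the circle by the real line; it traverses the circle once per unit
   interval, so arc length is normalized to total length 1. *)
definition circle_proj :: "real \<Rightarrow> complex" where
  "circle_proj t = cis (2 * pi * t)"

definition is_lift :: "(real \<Rightarrow> real) \<Rightarrow> (complex \<Rightarrow> complex) \<Rightarrow> bool" where
  "is_lift F g \<longleftrightarrow> continuous_on UNIV F \<and> (\<forall>t. g (circle_proj t) = circle_proj (F t))"

(* Maps of the circle are functions on the ambient type complex; their values off the circle
   are unconstrained and never used. Any two lifts of g differ by a constant integer, so if one
   lift is increasing, all are. *)
definition Hplus :: "(complex \<Rightarrow> complex) set" where
  "Hplus = {g. (\<exists>h. homeomorphism circle circle g h) \<and> (\<exists>F. is_lift F g \<and> strict_mono F)}"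

definition circle_borel :: "complex measure" where
  "circle_borel = restrict_space borel circle"

definition finite_borel_measures :: "complex measure set" where
  "finite_borel_measures = {\<mu>. sets \<mu> = sets circle_borel \<and> finite_measure \<mu>}"

definition borel_prob_measures :: "complex measure set" where
  "borel_prob_measures = {\<mu>. sets \<mu> = sets circle_borel \<and> prob_space \<mu>}"

(* measure_of yields the null measure if the given set function is not a measure;
   emeasure_markov_op below shows that this does not happen here. *)
definition markov_op ::
    "(complex \<Rightarrow> complex) set \<Rightarrow> ((complex \<Rightarrow> complex) \<Rightarrow> real) \<Rightarrow> complex measure \<Rightarrow> complex measure"
  where
  "markov_op \<Gamma> p \<mu> = measure_of circle (sets circle_borel)
     (\<lambda>A. \<Sum>g\<in>\<Gamma>. ennreal (p g) * emeasure (distr \<mu> circle_borel g) A)"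

definition invariant_measure ::
    "(complex \<Rightarrow> complex) set \<Rightarrow> ((complex \<Rightarrow> complex) \<Rightarrow> real) \<Rightarrow> complex measure \<Rightarrow> bool"
  where
  "invariant_measure \<Gamma> p \<mu> \<longleftrightarrow> markov_op \<Gamma> p \<mu> = \<mu>"

definition admissible :: "(complex \<Rightarrow> complex) set \<Rightarrow> bool" where
  "admissible \<Gamma> \<longleftrightarrow> (\<exists>g\<in>\<Gamma>. \<exists>x\<in>circle. circle \<subseteq> closure {(g ^^ n) x | n. n \<ge> 1})"

lemma space_circle_borel [simp]: "space circle_borel = circle"
  by (simp add: circle_borel_def space_restrict_space)

lemma sets_markov_op [simp]: "sets (markov_op \<Gamma> p \<mu>) = sets circle_borel"
  using sets.sigma_sets_eq[of circle_borel] sets.space_closed[of circle_borel]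
  by (simp add: markov_op_def)

lemma space_markov_op [simp]: "space (markov_op \<Gamma> p \<mu>) = circle"
  using sets_eq_imp_space_eq[OF sets_markov_op] by simp

lemma Hplus_measurable:
  assumes "g \<in> Hplus"
  shows "g \<in> measurable circle_borel circle_borel"
proof -
  obtain h where "homeomorphism circle circle g h"
    using assms by (auto simp: Hplus_def)
  then have "continuous_on circle g" and "g ` circle = circle"
    by (auto simp: homeomorphism_def)
  then show ?thesis
    unfolding circle_borel_def
    by (intro measurable_restrict_space2 borel_measurable_continuous_on_restrict)
       (auto simp: space_restrict_space)
qed

lemma emeasure_markov_op:
  assumes "\<Gamma> \<subseteq> Hplus" and "sets \<mu> = sets circle_borel" and "A \<in> sets circle_borel"
  shows "emeasure (markov_op \<Gamma> p \<mu>) A = (\<Sum>g\<in>\<Gamma>. ennreal (p g) * emeasure \<mu> (g -` A \<inter> circle))"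
proof -
  let ?f = "\<lambda>A. \<Sum>g\<in>\<Gamma>. ennreal (p g) * emeasure (distr \<mu> circle_borel g) A"
  have sp: "space \<mu> = circle"
    using sets_eq_imp_space_eq[OF assms(2)] by simp
  have meas: "g \<in> measurable \<mu> circle_borel" if "g \<in> \<Gamma>" for g
    using Hplus_measurable that assms(1) measurable_cong_sets[OF assms(2) refl] by blast
  have "emeasure (markov_op \<Gamma> p \<mu>) A = ?f A"
  proof (rule emeasure_measure_of[OF markov_op_def])
    show "sets circle_borel \<subseteq> Pow circle"
      using sets.space_closed[of circle_borel] by simp
    show "A \<in> sets (markov_op \<Gamma> p \<mu>)"
      using assms(3) by simp
    show "positive (sets (markov_op \<Gamma> p \<mu>)) ?f"
      by (simp add: positive_def)
    show "countably_additive (sets (markov_op \<Gamma> p \<mu>)) ?f"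
      unfolding countably_additive_def
      by (auto simp: suminf_sum suminf_emeasure)
  qed
  also have "\<dots> = (\<Sum>g\<in>\<Gamma>. ennreal (p g) * emeasure \<mu> (g -` A \<inter> circle))"
    using meas assms(3) by (intro sum.cong) (simp_all add: emeasure_distr sp)
  finally show ?thesis .
qed

lemma markov_op_finite:
  assumes "\<Gamma> \<subseteq> Hplus" and "\<mu> \<in> finite_borel_measures"
  shows "markov_op \<Gamma> p \<mu> \<in> finite_borel_measures"
proof -
  have \<mu>: "sets \<mu> = sets circle_borel" and "finite_measure \<mu>"
    using assms(2) by (auto simp: finite_borel_measures_def)
  interpret finite_measure \<mu> by fact
  have "circle \<in> sets circle_borel"
    using sets.top[of circle_borel] by simp
  moreover have "(\<Sum>g\<in>\<Gamma>. ennreal (p g) * emeasure \<mu> (g -` circle \<inter> circle)) < \<infinity>"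
    by (induction \<Gamma> rule: infinite_finite_induct)
       (simp_all add: emeasure_eq_measure ennreal_mult_less_top)
  ultimately have "emeasure (markov_op \<Gamma> p \<mu>) (space (markov_op \<Gamma> p \<mu>)) \<noteq> \<infinity>"
    using emeasure_markov_op[OF assms(1) \<mu>, of circle p] by simp
  then show ?thesis
    by (auto simp: finite_borel_measures_def intro: finite_measureI)
qed

end

theory Submission
  imports Defs
begin

text \<open>Everything is transported to lifts. With the coordinate \<open>x(z) \<in> (-1/2, 1/2]\<close> of a point of the
  circle, a probability measure \<open>\<mu>\<close> becomes, up to an additive constant, the monotone function
  \<open>F(t) = \<integral> \<lfloor>t - x(z)\<rfloor> d\<mu>(z)\<close>, which satisfies \<open>F(t + 1) = F(t) + 1\<close>. If \<open>H\<^sub>g\<close> lifts the inverse of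
  \<open>g\<close>, then \<open>\<mu>\<close> is invariant iff \<open>\<Sum>\<^sub>g p(g) F(H\<^sub>g t) = F(t) + c\<close> for some constant \<open>c\<close>.

  Existence is a Krylov--Bogoliubov argument for such \<open>F\<close> in the topology of pointwise convergence.

  For uniqueness, minimality excludes atoms, so the difference \<open>D\<close> of the functions of two invariant
  measures is continuous and 1-periodic with \<open>\<Sum>\<^sub>g p(g) D(H\<^sub>g t) = D(t) + c\<close>. Evaluating at a maximum and
  at a minimum gives \<open>c = 0\<close>, so the set of maxima is invariant under the inverse of the
  element with a dense orbit, hence is everything, and \<open>D\<close> is constant.\<close>

section \<open>Monotone functions of degree one\<close>

text \<open>The increment 1 is the degree for a lift of a circle map and the total mass for a lifted
  distribution function.\<close>

definition degree_one :: "(real \<Rightarrow> real) \<Rightarrow> bool" where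
  "degree_one F \<longleftrightarrow> (\<forall>t. F (t + 1) = F t + 1)"

lemma degree_one_add_int:
  assumes "degree_one F" shows "F (t + of_int k) = F t + of_int k"
proof (induction k rule: int_induct[where k = 0])
  case (step1 i)
  then show ?case
    using assms by (simp add: degree_one_def add.assoc[symmetric])
next
  case (step2 i)
  have "F (t + of_int i) = F (t + of_int (i - 1)) + 1"
    using assms[unfolded degree_one_def, rule_format, of "t + of_int (i - 1)"] by simp
  with step2 show ?case by simp
qed simp

text \<open>\<open>F - K\<close> is 1-periodic, so one period starting at \<open>a\<close> decides
  all \<open>t\<close>. Distribution functions are compared this way because they matter only up to
  a constant.\<close>

lemma degree_one_diff_eqI:
  assumes "degree_one F" "degree_one K"
    and "\<And>t. a \<le> t \<Longrightarrow> t \<le> a + 1 \<Longrightarrow> F t - F a = K t - K a"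
  shows "F t - F a = K t - K a"
proof -
  define k where "k = \<lfloor>t - a\<rfloor>"
  have "F (t - of_int k) - F a = K (t - of_int k) - K a"
    by (rule assms(3)) (simp_all add: k_def, linarith+)
  then show ?thesis
    using degree_one_add_int[OF assms(1), of "t - of_int k" k]
      degree_one_add_int[OF assms(2), of "t - of_int k" k] by simp
qed

text \<open>At integers \<open>F\<close> is known exactly in terms of \<open>F 0\<close>, and
  monotonicity interpolates between floor and ceiling. The uniformity in \<open>F\<close> later
  gives compactness.\<close>

lemma mono_degree_one_bounds:
  assumes "mono F" "degree_one F"
  shows "t - 1 \<le> F t - F 0" and "F t - F 0 \<le> t + 1"
proof -
  have "F (of_int \<lfloor>t\<rfloor>) = F 0 + of_int \<lfloor>t\<rfloor>" "F (of_int \<lceil>t\<rceil>) = F 0 + of_int \<lceil>t\<rceil>"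
    using degree_one_add_int[OF assms(2), of 0] by simp_all
  moreover have "F (of_int \<lfloor>t\<rfloor>) \<le> F t" "F t \<le> F (of_int \<lceil>t\<rceil>)"
    by (rule monoD[OF assms(1)]; linarith)+
  ultimately show "t - 1 \<le> F t - F 0" "F t - F 0 \<le> t + 1" by linarith+
qed

section \<open>Coordinates on the circle\<close>

lemma norm_circle_proj [simp]: "norm (circle_proj t) = 1"
  by (simp add: circle_proj_def)

lemma circle_proj_in_circle: "circle_proj t \<in> circle"
  by simp

lemma circle_proj_add_int [simp]: "circle_proj (t + of_int k) = circle_proj t"
  by (simp add: circle_proj_def distrib_left cis_mult [symmetric])

lemma circle_proj_eq_iff: "circle_proj s = circle_proj t \<longleftrightarrow> (\<exists>k::int. s = t + of_int k)"
proof
  assume "circle_proj s = circle_proj t"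
  then have "sin (2 * pi * s) = sin (2 * pi * t) \<and> cos (2 * pi * s) = cos (2 * pi * t)"
    by (simp add: circle_proj_def complex_eq_iff)
  then obtain k :: int where "2 * pi * s = 2 * pi * t + 2 * pi * k"
    unfolding sin_cos_eq_iff by blast
  then have "2 * pi * s = 2 * pi * (t + k)" by (simp add: algebra_simps)
  then have "s = t + of_int k" by simp
  then show "\<exists>k::int. s = t + of_int k" by blast
qed auto

lemma continuous_on_circle_proj [continuous_intros]: "continuous_on S circle_proj"
  unfolding circle_proj_def by (intro continuous_intros)

text \<open>The section of \<open>circle_proj\<close> over one half-open period ending at 1/2; on
  the circle its jump is at -1.\<close>

definition circle_coord :: "complex \<Rightarrow> real" where
  "circle_coord z = Arg z / (2 * pi)"

lemma circle_coord_bounds: "- 1 / 2 < circle_coord z" "circle_coord z \<le> 1 / 2"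
  using Arg_bounded[of z] by (simp_all add: circle_coord_def field_simps)

lemma circle_proj_coord [simp]: "z \<in> circle \<Longrightarrow> circle_proj (circle_coord z) = z"
proof -
  assume "z \<in> circle"
  then have "norm z = 1" "z \<noteq> 0" by auto
  then show ?thesis
    by (simp add: circle_proj_def circle_coord_def cis_Arg sgn_div_norm)
qed

lemma circle_eq_range_proj: "circle = range circle_proj"
  using circle_proj_coord by (metis circle_proj_in_circle image_subset_iff rangeI subsetI subset_antisym)

lemma circle_coord_proj:
  assumes "- 1 / 2 < t" "t \<le> 1 / 2" shows "circle_coord (circle_proj t) = t"
proof -
  have "Arg (circle_proj t) = 2 * pi * t"
  proof (rule cis_Arg_unique)
    show "sgn (circle_proj t) = cis (2 * pi * t)"
      by (simp add: circle_proj_def sgn_div_norm)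
    show "- pi < 2 * pi * t"
      using mult_strict_left_mono[OF assms(1), of "2 * pi"] by simp
    show "2 * pi * t \<le> pi"
      using mult_left_mono[OF assms(2), of "2 * pi"] by simp
  qed
  then show ?thesis by (simp add: circle_coord_def)
qed

text \<open>\<open>Arg\<close> is continuous off the nonpositive reals, and on them it is constantly
  \<open>pi\<close> except for the value 0 at the origin.\<close>

lemma borel_measurable_Arg: "Arg \<in> borel_measurable borel"
proof -
  have [measurable]: "\<real>\<^sub>\<le>\<^sub>0 \<in> sets (borel :: complex measure)"
    by (intro borel_closed closed_nonpos_Reals_complex)
  have "Arg \<in> borel_measurable (restrict_space borel (- \<real>\<^sub>\<le>\<^sub>0))"
    by (intro borel_measurable_continuous_on_restrict continuous_on_Arg)
  then have [measurable]: "(\<lambda>z. indicator (- \<real>\<^sub>\<le>\<^sub>0) z *\<^sub>R Arg z) \<in> borel_measurable borel"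
    by (subst (asm) borel_measurable_restrict_space_iff) (auto intro: borel_open closed_nonpos_Reals_complex)
  have "Arg = (\<lambda>z. indicator (- \<real>\<^sub>\<le>\<^sub>0) z *\<^sub>R Arg z + pi * indicator (\<real>\<^sub>\<le>\<^sub>0 - {0}) z)"
  proof
    fix z
    show "Arg z = indicator (- \<real>\<^sub>\<le>\<^sub>0) z *\<^sub>R Arg z + pi * indicator (\<real>\<^sub>\<le>\<^sub>0 - {0}) z"
    proof (cases "z = 0")
      case False
      then show ?thesis
        using Arg_eq_pi[of z] by (auto simp: indicator_def complex_nonpos_Reals_iff complex_eq_iff)
    qed (simp add: Arg_zero)
  qed
  moreover have "(\<lambda>z. indicator (- \<real>\<^sub>\<le>\<^sub>0) z *\<^sub>R Arg z + pi * indicator (\<real>\<^sub>\<le>\<^sub>0 - {0}) z)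
      \<in> borel_measurable borel"
    by measurable
  ultimately show ?thesis by simp
qed

lemma measurable_circle_coord [measurable]: "circle_coord \<in> borel_measurable circle_borel"
  unfolding circle_borel_def circle_coord_def
  by (intro measurable_restrict_space1 borel_measurable_divide borel_measurable_Arg borel_measurable_const)

lemma measurable_circle_proj [measurable]: "circle_proj \<in> measurable borel circle_borel"
  unfolding circle_borel_def
  by (intro measurable_restrict_space2 borel_measurable_continuous_onI continuous_intros)
     (use circle_proj_in_circle in blast)

text \<open>The difference of the two floors counts the integers \<open>k\<close> with
  \<open>s < circle_coord z + k \<le> t\<close>, that is, the lifts of \<open>z\<close> in the
  half-open interval.\<close>

lemma in_circle_arc_iff:
  assumes "z \<in> circle" "s \<le> t"
  shows "z \<in> circle_proj ` {s<..t} \<longleftrightarrow> \<lfloor>s - circle_coord z\<rfloor> < \<lfloor>t - circle_coord z\<rfloor>"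
proof
  assume "z \<in> circle_proj ` {s<..t}"
  then obtain u where u: "s < u" "u \<le> t" "z = circle_proj u" by auto
  then have "circle_proj u = circle_proj (circle_coord z)" using assms by simp
  then obtain k :: int where "u = circle_coord z + of_int k"
    unfolding circle_proj_eq_iff by blast
  with u have "\<lfloor>s - circle_coord z\<rfloor> < k" "k \<le> \<lfloor>t - circle_coord z\<rfloor>" by linarith+
  then show "\<lfloor>s - circle_coord z\<rfloor> < \<lfloor>t - circle_coord z\<rfloor>" by simp
next
  assume "\<lfloor>s - circle_coord z\<rfloor> < \<lfloor>t - circle_coord z\<rfloor>"
  then have "circle_coord z + of_int \<lfloor>t - circle_coord z\<rfloor> \<in> {s<..t}" by auto linarith+
  then show "z \<in> circle_proj ` {s<..t}"
    by (rule rev_image_eqI) (use assms in simp)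
qed

lemma circle_arc_in_sets: "circle_proj ` {s<..t} \<in> sets circle_borel"
proof (cases "s \<le> t")
  case True
  then have "circle_proj ` {s<..t} =
    {z \<in> space circle_borel. \<lfloor>s - circle_coord z\<rfloor> < \<lfloor>t - circle_coord z\<rfloor>}"
    using in_circle_arc_iff[OF _ True] circle_proj_in_circle unfolding space_circle_borel by blast
  also have "\<dots> \<in> sets circle_borel" by measurable
  finally show ?thesis .
qed simp

section \<open>Lifted distribution functions\<close>

text \<open>Increments of the integrand count lifts of \<open>z\<close>, so increments of the
  integral measure lifted arcs with no case distinction at the jump of the coordinate.\<close>

definition circle_cdf :: "complex measure \<Rightarrow> real \<Rightarrow> real" where
  "circle_cdf \<mu> t = (\<integral>z. of_int \<lfloor>t - circle_coord z\<rfloor> \<partial>\<mu>)"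

lemma abs_floor_minus_coord_le: "\<bar>of_int \<lfloor>t - circle_coord z\<rfloor>\<bar> \<le> \<bar>t\<bar> + (2 :: real)"
  using circle_coord_bounds[of z] by linarith

lemma borel_prob_measuresD:
  assumes "\<mu> \<in> borel_prob_measures"
  shows "prob_space \<mu>" "sets \<mu> = sets circle_borel" "space \<mu> = circle"
  using assms sets_eq_imp_space_eq[of \<mu> circle_borel] by (auto simp: borel_prob_measures_def)

context
  fixes \<mu> assumes \<mu>: "\<mu> \<in> borel_prob_measures"
begin

interpretation prob_space \<mu> by (rule borel_prob_measuresD[OF \<mu>])

lemma sets_borel_prob_measure [measurable_cong]: "sets \<mu> = sets circle_borel"
  by (rule borel_prob_measuresD[OF \<mu>])

lemma integrable_floor_minus_coord:
  "integrable \<mu> (\<lambda>z. of_int \<lfloor>t - circle_coord z\<rfloor> :: real)"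
  by (rule integrable_const_bound[where B = "\<bar>t\<bar> + 2"])
     (use abs_floor_minus_coord_le in auto)

lemma degree_one_circle_cdf: "degree_one (circle_cdf \<mu>)"
  unfolding degree_one_def
proof
  fix t
  have "\<lfloor>t + 1 - circle_coord z\<rfloor> = \<lfloor>t - circle_coord z\<rfloor> + 1" for z by linarith
  then show "circle_cdf \<mu> (t + 1) = circle_cdf \<mu> t + 1"
    unfolding circle_cdf_def
    using integrable_floor_minus_coord[of t] by (simp add: prob_space)
qed

text \<open>Within one period a point has at most one lift, so the count of lifts is an indicator;
  longer intervals would count points with multiplicity.\<close>

lemma circle_cdf_diff:
  assumes "s \<le> t" "t \<le> s + 1"
  shows "circle_cdf \<mu> t - circle_cdf \<mu> s = measure \<mu> (circle_proj ` {s<..t})"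
proof -
  have "circle_cdf \<mu> t - circle_cdf \<mu> s =
    (\<integral>z. of_int \<lfloor>t - circle_coord z\<rfloor> - of_int \<lfloor>s - circle_coord z\<rfloor> \<partial>\<mu>)"
    unfolding circle_cdf_def
    by (rule Bochner_Integration.integral_diff[symmetric]; rule integrable_floor_minus_coord)
  also have "\<dots> = (\<integral>z. indicator (circle_proj ` {s<..t}) z \<partial>\<mu>)"
  proof (rule Bochner_Integration.integral_cong)
    fix z assume "z \<in> space \<mu>"
    then have z: "z \<in> circle" using borel_prob_measuresD[OF \<mu>] by simp
    have "\<lfloor>s - circle_coord z\<rfloor> \<le> \<lfloor>t - circle_coord z\<rfloor>" "\<lfloor>t - circle_coord z\<rfloor> \<le> \<lfloor>s - circle_coord z\<rfloor> + 1"
      using assms by linarith+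
    then show "of_int \<lfloor>t - circle_coord z\<rfloor> - of_int \<lfloor>s - circle_coord z\<rfloor> =
        (indicator (circle_proj ` {s<..t}) z :: real)"
      using in_circle_arc_iff[OF z assms(1)] by (auto simp: indicator_def)
  qed simp
  also have "\<dots> = measure \<mu> (circle_proj ` {s<..t})"
    using circle_arc_in_sets[of s t] by (simp add: sets_borel_prob_measure)
  finally show ?thesis .
qed

lemma distr_coord_proj: "distr (distr \<mu> borel circle_coord) circle_borel circle_proj = \<mu>"
proof -
  have "distr (distr \<mu> borel circle_coord) circle_borel circle_proj =
    distr \<mu> circle_borel (circle_proj \<circ> circle_coord)"
    by (rule distr_distr) measurable
  also have "\<dots> = distr \<mu> \<mu> (\<lambda>z. z)"
    by (rule distr_cong) (use borel_prob_measuresD[OF \<mu>] in auto)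
  finally show ?thesis by (simp add: distr_id)
qed

text \<open>The coordinate ranges over one half-open period, so its law on the line is described by
  increments of \<open>circle_cdf\<close> from -1/2, frozen at both ends.\<close>

lemma cdf_distr_circle_coord:
  "cdf (distr \<mu> borel circle_coord) t = 
    (if t < - 1 / 2 then 0 else circle_cdf \<mu> (min t (1 / 2)) - circle_cdf \<mu> (- 1 / 2))"
proof -
  have "cdf (distr \<mu> borel circle_coord) t = measure \<mu> {z \<in> circle. circle_coord z \<le> t}"
    unfolding cdf_def using borel_prob_measuresD[OF \<mu>]
    by (subst measure_distr) (auto intro!: arg_cong[where f = "measure \<mu>"])
  also have "\<dots> = (if t < - 1 / 2 then 0 else circle_cdf \<mu> (min t (1 / 2)) - circle_cdf \<mu> (- 1 / 2))"
  proof (cases "t < - 1 / 2")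
    case True
    then have "\<not> circle_coord z \<le> t" for z
      using circle_coord_bounds[of z] by linarith
    then show ?thesis using True by simp
  next
    case False
    have "circle_coord z \<le> t \<longleftrightarrow> z \<in> circle_proj ` {- 1 / 2 <.. min t (1 / 2)}" if "z \<in> circle" for z
    proof -
      have "\<lfloor>- 1 / 2 - circle_coord z\<rfloor> = - 1"
        using circle_coord_bounds[of z] by linarith
      moreover have "circle_coord z \<le> t \<longleftrightarrow> 0 \<le> \<lfloor>min t (1 / 2) - circle_coord z\<rfloor>"
        using circle_coord_bounds(2)[of z] by simp
      moreover have "z \<in> circle_proj ` {- 1 / 2 <.. min t (1 / 2)} \<longleftrightarrow>
          \<lfloor>- 1 / 2 - circle_coord z\<rfloor> < \<lfloor>min t (1 / 2) - circle_coord z\<rfloor>"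
        using False that by (intro in_circle_arc_iff) auto
      ultimately show ?thesis by linarith
    qed
    then have "{z \<in> circle. circle_coord z \<le> t} = circle_proj ` {- 1 / 2 <.. min t (1 / 2)}"
      using circle_proj_in_circle by blast
    then show ?thesis
      using False by (subst circle_cdf_diff) auto
  qed
  finally show ?thesis .
qed

end

text \<open>Additive constants cancel in increments, so both laws of the coordinate have the same
  distribution function on the line and coincide; projecting back recovers the measures.\<close>

lemma circle_cdf_inject:
  assumes "\<mu> \<in> borel_prob_measures" "\<nu> \<in> borel_prob_measures"
    and "\<And>t. circle_cdf \<mu> t = circle_cdf \<nu> t + c"
  shows "\<mu> = \<nu>"
proof -
  have "real_distribution (distr m borel circle_coord)" if "m \<in> borel_prob_measures" for m
  proof -
    interpret prob_space m by (rule borel_prob_measuresD[OF that])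
    have "circle_coord \<in> borel_measurable m"
      using measurable_circle_coord measurable_cong_sets[OF borel_prob_measuresD(2)[OF that] refl]
      by blast
    then show ?thesis by (rule real_distribution_distr)
  qed
  then have "distr \<mu> borel circle_coord = distr \<nu> borel circle_coord"
    using assms by (intro cdf_unique) (auto simp: cdf_distr_circle_coord)
  then show ?thesis
    using distr_coord_proj assms by metis
qed

section \<open>Lifts of circle homeomorphisms\<close>

text \<open>Packages a lift \<open>G\<close> with its inverse \<open>H\<close>: \<open>G\<close>
  describes the circle map, while \<open>H\<close> acts on distribution functions.\<close>

definition real_degree_one_homeo :: "(real \<Rightarrow> real) \<Rightarrow> (real \<Rightarrow> real) \<Rightarrow> bool" where
  "real_degree_one_homeo G H \<longleftrightarrow>
     homeomorphism UNIV UNIV G H \<and> strict_mono G \<and> strict_mono H \<and> degree_one G \<and> degree_one H"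

lemma real_degree_one_lift_homeoD:
  assumes "real_degree_one_homeo G H"
  shows "strict_mono G" "strict_mono H" "degree_one G" "degree_one H"
    "G (H t) = t" "H (G t) = t" "continuous_on UNIV G" "continuous_on UNIV H"
  using assms by (auto simp: real_degree_one_homeo_def homeomorphism_def)

text \<open>The increment over a period is an integer, positive by monotonicity. If it were at least
  2, the intermediate value theorem would give a point strictly inside the period with image shifted
  by exactly 1, and \<open>g\<close> would not be injective.\<close>

lemma Hplus_degree_one_lift:
  assumes "g \<in> Hplus" "is_lift G g" "strict_mono G"
  shows "degree_one G"
  unfolding degree_one_def
proof
  fix t
  obtain h where h: "homeomorphism circle circle g h" using assms(1) by (auto simp: Hplus_def)
  have lift: "g (circle_proj s) = circle_proj (G s)" for s
    using assms(2) by (auto simp: is_lift_def)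
  have "circle_proj (G (t + 1)) = circle_proj (G t)"
    using lift[of "t + 1"] lift[of t] circle_proj_add_int[of t 1] by simp
  then obtain k :: int where k: "G (t + 1) = G t + of_int k"
    unfolding circle_proj_eq_iff by blast
  moreover have "G t < G (t + 1)" using assms(3) by (simp add: strict_monoD)
  ultimately have "k > 0" by simp
  moreover have False if "k \<ge> 2"
  proof -
    have cont: "continuous_on {t..t + 1} G"
      using assms(2) continuous_on_subset by (auto simp: is_lift_def)
    have "1 \<le> (of_int k :: real)" using that by simp
    then obtain s where s: "t \<le> s" "s \<le> t + 1" "G s = G t + 1"
      using IVT'[of G t "G t + 1" "t + 1"] cont k by auto
    have "s \<noteq> t" "s \<noteq> t + 1" using s(3) k that by auto
    moreover have "circle_proj (G s) = circle_proj (G t)"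
      using s(3) circle_proj_add_int[of "G t" 1] by simp
    then have "g (circle_proj s) = g (circle_proj t)" by (simp add: lift)
    then have "circle_proj s = circle_proj t"
      using h by (metis circle_proj_in_circle homeomorphism_apply1)
    then obtain j :: int where "s = t + of_int j" unfolding circle_proj_eq_iff by blast
    ultimately have "0 < j" "j < 1" using s by auto
    then show False by simp
  qed
  ultimately have "k = 1" by presburger
  with k show "G (t + 1) = G t + 1" by simp
qed

lemma degree_one_surj:
  assumes "continuous_on UNIV G" "degree_one G"
  shows "\<exists>t. G t = (y :: real)"
proof -
  define a where "a = \<lfloor>y - G 0\<rfloor>"
  have "G (of_int a) = G 0 + of_int a" "G (of_int (a + 1)) = G 0 + of_int (a + 1)"
    using degree_one_add_int[OF assms(2), of 0 a] degree_one_add_int[OF assms(2), of 0 "a + 1"]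
    by simp_all
  moreover have "of_int a \<le> y - G 0" "y - G 0 \<le> of_int (a + 1)"
    unfolding a_def by linarith+
  ultimately have "G (of_int a) \<le> y" "y \<le> G (of_int (a + 1))" by linarith+
  then show ?thesis
    using IVT'[of G "of_int a" y "of_int (a + 1)"] continuous_on_subset[OF assms(1)] by auto
qed

text \<open>Degree one makes the lift surjective, so the strictly increasing \<open>G\<close> has a
  continuous inverse, which inherits monotonicity and degree.\<close>

lemma Hplus_lift:
  assumes "g \<in> Hplus"
  obtains G H where "real_degree_one_homeo G H" "\<And>t. g (circle_proj t) = circle_proj (G t)"
proof -
  obtain G where G: "is_lift G g" "strict_mono G" using assms by (auto simp: Hplus_def)
  have cont: "continuous_on UNIV G" and lift: "g (circle_proj t) = circle_proj (G t)" for t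
    using G(1) by (auto simp: is_lift_def)
  have deg: "degree_one G" by (rule Hplus_degree_one_lift[OF assms G])
  have "surj G" using degree_one_surj[OF cont deg] by (metis surjI)
  then obtain H where "homeomorphism UNIV UNIV G H"
    using homeomorphism_into_1d[of UNIV G UNIV] cont strict_mono_imp_inj_on[OF G(2)] by auto
  then have H: "\<And>t. G (H t) = t" "\<And>t. H (G t) = t"
    by (auto simp: homeomorphism_def)
  have "strict_mono H"
    by (rule strict_monoI) (metis G(2) H(1) strict_mono_less)
  moreover have "degree_one H"
    unfolding degree_one_def by (metis H deg degree_one_def)
  ultimately show ?thesis
    using that[of G H] lift deg G(2) \<open>homeomorphism UNIV UNIV G H\<close>
    by (auto simp: real_degree_one_homeo_def)
qed

text \<open>\<open>G x\<close> lies in an integer translate of the interval exactly when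
  \<open>x\<close> lies in a translate of its image under the increasing map \<open>H\<close>. This
  is why inverse lifts act on distribution functions.\<close>

lemma lift_vimage_arc:
  assumes "real_degree_one_homeo G H" "\<And>t. g (circle_proj t) = circle_proj (G t)"
  shows "g -` (circle_proj ` {s<..t}) \<inter> circle = circle_proj ` {H s<..H t}"
proof (intro set_eqI iffI)
  note GH = real_degree_one_lift_homeoD[OF assms(1)]
  fix z assume "z \<in> g -` (circle_proj ` {s<..t}) \<inter> circle"
  then obtain u x where u: "u \<in> {s<..t}" "g z = circle_proj u" and x: "z = circle_proj x"
    unfolding circle_eq_range_proj by auto
  then obtain k :: int where "u = G x + of_int k"
    using assms(2) by (metis circle_proj_eq_iff)
  then have "G (x + of_int k) = u" using degree_one_add_int[OF GH(3)] by simp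
  then have "H s < x + of_int k" "x + of_int k \<le> H t"
    using u(1) GH(1,5) by (metis greaterThanAtMost_iff strict_mono_less strict_mono_less_eq)+
  then show "z \<in> circle_proj ` {H s<..H t}"
    by (intro rev_image_eqI[of "x + of_int k"]) (auto simp: x)
next
  note GH = real_degree_one_lift_homeoD[OF assms(1)]
  fix z assume "z \<in> circle_proj ` {H s<..H t}"
  then obtain x where x: "H s < x" "x \<le> H t" "z = circle_proj x" by auto
  then have "s < G x" "G x \<le> t"
    using GH(1,5) by (metis strict_mono_less strict_mono_less_eq)+
  then show "z \<in> g -` (circle_proj ` {s<..t}) \<inter> circle"
    using assms(2) x(3) by auto
qed

section \<open>The Markov operator on distribution functions\<close>

text \<open>The Markov operator as it acts on lifted distribution functions, when each
  \<open>H i\<close> lifts an inverse. The index type is left open so that translation by 1 can be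
  treated as a one-element system.\<close>

definition transfer_op :: "'i set \<Rightarrow> ('i \<Rightarrow> real) \<Rightarrow> ('i \<Rightarrow> real \<Rightarrow> real) \<Rightarrow> (real \<Rightarrow> real) \<Rightarrow> real \<Rightarrow> real"
  where "transfer_op I p H F t = (\<Sum>i\<in>I. p i * F (H i t))"

lemma degree_one_transfer_op:
  assumes "\<And>i. i \<in> I \<Longrightarrow> degree_one (H i)" "degree_one F" "sum p I = 1"
  shows "degree_one (transfer_op I p H F)"
  using assms by (simp add: degree_one_def transfer_op_def distrib_left sum.distrib)

lemma mono_transfer_op:
  assumes "\<And>i. i \<in> I \<Longrightarrow> mono (H i)" "\<And>i. i \<in> I \<Longrightarrow> 0 \<le> p i" "mono F"
  shows "mono (transfer_op I p H F)"
  unfolding transfer_op_def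
  by (intro monoI sum_mono mult_left_mono) (use assms in \<open>auto simp: mono_def\<close>)

context
  fixes \<Gamma> :: "(complex \<Rightarrow> complex) set" and p :: "(complex \<Rightarrow> complex) \<Rightarrow> real"
  assumes sub: "\<Gamma> \<subseteq> Hplus"
    and weights_nonneg: "\<And>g. g \<in> \<Gamma> \<Longrightarrow> 0 \<le> p g" and sum1: "sum p \<Gamma> = 1"
begin

lemma measure_markov_op:
  assumes "\<mu> \<in> borel_prob_measures" "A \<in> sets circle_borel"
  shows "measure (markov_op \<Gamma> p \<mu>) A = (\<Sum>g\<in>\<Gamma>. p g * measure \<mu> (g -` A \<inter> circle))"
proof -
  interpret prob_space \<mu> by (rule borel_prob_measuresD[OF assms(1)])
  have "emeasure (markov_op \<Gamma> p \<mu>) A = (\<Sum>g\<in>\<Gamma>. ennreal (p g) * emeasure \<mu> (g -` A \<inter> circle))"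
    by (rule emeasure_markov_op[OF sub borel_prob_measuresD(2)[OF assms(1)] assms(2)])
  also have "\<dots> = (\<Sum>g\<in>\<Gamma>. ennreal (p g * measure \<mu> (g -` A \<inter> circle)))"
    by (intro sum.cong) (simp_all add: emeasure_eq_measure ennreal_mult' weights_nonneg)
  also have "\<dots> = ennreal (\<Sum>g\<in>\<Gamma>. p g * measure \<mu> (g -` A \<inter> circle))"
    by (rule sum_ennreal) (simp add: weights_nonneg)
  finally show ?thesis
    unfolding measure_def by (simp add: sum_nonneg weights_nonneg)
qed

lemma markov_op_prob:
  assumes "\<mu> \<in> borel_prob_measures"
  shows "markov_op \<Gamma> p \<mu> \<in> borel_prob_measures"
proof -
  interpret \<mu>: prob_space \<mu> by (rule borel_prob_measuresD[OF assms])
  have "markov_op \<Gamma> p \<mu> \<in> finite_borel_measures"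
    by (rule markov_op_finite[OF sub])
       (use borel_prob_measuresD[OF assms] \<mu>.finite_measure_axioms in \<open>simp add: finite_borel_measures_def\<close>)
  then interpret finite_measure "markov_op \<Gamma> p \<mu>" by (simp add: finite_borel_measures_def)
  have "g -` circle \<inter> circle = circle" if "g \<in> \<Gamma>" for g
  proof -
    have "g ` circle = circle"
      using sub that unfolding Hplus_def homeomorphism_def by blast
    then show ?thesis by blast
  qed
  moreover have "measure \<mu> circle = 1"
    using \<mu>.prob_space borel_prob_measuresD(3)[OF assms] by simp
  ultimately have "measure (markov_op \<Gamma> p \<mu>) circle = 1"
    using sets.top[of circle_borel] by (simp add: measure_markov_op[OF assms] sum1)
  then have "emeasure (markov_op \<Gamma> p \<mu>) (space (markov_op \<Gamma> p \<mu>)) = 1"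
    by (simp add: emeasure_eq_measure)
  then show ?thesis
    by (auto simp: borel_prob_measures_def intro: prob_spaceI)
qed

text \<open>Arcs within one period suffice by \<open>degree_one_diff_eqI\<close>. Each
  \<open>H g\<close> has degree one and carries them to intervals of length at most 1, where
  \<open>circle_cdf_diff\<close> applies.\<close>

lemma circle_cdf_markov_op:
  assumes "\<mu> \<in> borel_prob_measures"
    and "\<And>g. g \<in> \<Gamma> \<Longrightarrow> real_degree_one_homeo (G g) (H g)"
    and "\<And>g t. g \<in> \<Gamma> \<Longrightarrow> g (circle_proj t) = circle_proj (G g t)"
  shows "circle_cdf (markov_op \<Gamma> p \<mu>) t - circle_cdf (markov_op \<Gamma> p \<mu>) 0 =
    transfer_op \<Gamma> p H (circle_cdf \<mu>) t - transfer_op \<Gamma> p H (circle_cdf \<mu>) 0"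
proof (rule degree_one_diff_eqI)
  note GH = real_degree_one_lift_homeoD[OF assms(2)]
  show "degree_one (circle_cdf (markov_op \<Gamma> p \<mu>))"
    by (rule degree_one_circle_cdf[OF markov_op_prob[OF assms(1)]])
  show "degree_one (transfer_op \<Gamma> p H (circle_cdf \<mu>))"
    using GH(4) sum1 by (intro degree_one_transfer_op degree_one_circle_cdf assms(1))
  fix t :: real assume t: "0 \<le> t" "t \<le> 0 + 1"
  have "circle_cdf (markov_op \<Gamma> p \<mu>) t - circle_cdf (markov_op \<Gamma> p \<mu>) 0 =
      (\<Sum>g\<in>\<Gamma>. p g * measure \<mu> (g -` (circle_proj ` {0<..t}) \<inter> circle))"
    using t by (simp add: circle_cdf_diff[OF markov_op_prob[OF assms(1)]] circle_arc_in_sets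
      measure_markov_op[OF assms(1)])
  also have "\<dots> = (\<Sum>g\<in>\<Gamma>. p g * (circle_cdf \<mu> (H g t) - circle_cdf \<mu> (H g 0)))"
  proof (intro sum.cong arg_cong2[where f = "(*)"] refl)
    fix g assume g: "g \<in> \<Gamma>"
    have "H g 0 \<le> H g t" using GH(2)[OF g] t by (simp add: strict_mono_less_eq)
    moreover have "H g t \<le> H g (0 + 1)" using GH(2)[OF g] t by (simp add: strict_mono_less_eq)
    then have "H g t \<le> H g 0 + 1" using GH(4)[OF g, unfolded degree_one_def, rule_format, of 0] by simp
    ultimately show "measure \<mu> (g -` (circle_proj ` {0<..t}) \<inter> circle) =
        circle_cdf \<mu> (H g t) - circle_cdf \<mu> (H g 0)"
      by (simp add: circle_cdf_diff[OF assms(1)]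
        lift_vimage_arc[OF assms(2)[OF g] assms(3)[OF g]])
  qed
  also have "\<dots> = transfer_op \<Gamma> p H (circle_cdf \<mu>) t - transfer_op \<Gamma> p H (circle_cdf \<mu>) 0"
    by (simp add: transfer_op_def right_diff_distrib sum_subtractf)
  finally show "circle_cdf (markov_op \<Gamma> p \<mu>) t - circle_cdf (markov_op \<Gamma> p \<mu>) 0 =
    transfer_op \<Gamma> p H (circle_cdf \<mu>) t - transfer_op \<Gamma> p H (circle_cdf \<mu>) 0" .
qed

text \<open>The constant \<open>c\<close> reflects the choice of lifts: replacing some
  \<open>H g\<close> by an integer translate changes the left side of the equation by a
  constant.\<close>

lemma invariant_measure_iff_transfer_op:
  assumes "\<mu> \<in> borel_prob_measures"
    and "\<And>g. g \<in> \<Gamma> \<Longrightarrow> real_degree_one_homeo (G g) (H g)"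
    and "\<And>g t. g \<in> \<Gamma> \<Longrightarrow> g (circle_proj t) = circle_proj (G g t)"
  shows "invariant_measure \<Gamma> p \<mu> \<longleftrightarrow>
    (\<exists>c. \<forall>t. transfer_op \<Gamma> p H (circle_cdf \<mu>) t = circle_cdf \<mu> t + c)"
proof
  assume "invariant_measure \<Gamma> p \<mu>"
  then have "transfer_op \<Gamma> p H (circle_cdf \<mu>) t =
      circle_cdf \<mu> t + (transfer_op \<Gamma> p H (circle_cdf \<mu>) 0 - circle_cdf \<mu> 0)" for t
    using circle_cdf_markov_op[OF assms, of t] by (simp add: invariant_measure_def)
  then show "\<exists>c. \<forall>t. transfer_op \<Gamma> p H (circle_cdf \<mu>) t = circle_cdf \<mu> t + c" by blast
next
  assume "\<exists>c. \<forall>t. transfer_op \<Gamma> p H (circle_cdf \<mu>) t = circle_cdf \<mu> t + c"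
  then have "circle_cdf (markov_op \<Gamma> p \<mu>) t = circle_cdf \<mu> t +
      (circle_cdf (markov_op \<Gamma> p \<mu>) 0 - circle_cdf \<mu> 0)" for t
    using circle_cdf_markov_op[OF assms, of t] by auto
  then show "invariant_measure \<Gamma> p \<mu>"
    unfolding invariant_measure_def
    by (rule circle_cdf_inject[OF markov_op_prob[OF assms(1)] assms(1)])
qed

end

section \<open>Existence\<close>

text \<open>One period of \<open>F\<close> defines a Lebesgue-Stieltjes probability measure on the
  line; its projection to the circle is the desired measure.\<close>

lemma prob_measure_of_circle_cdf:
  assumes "mono F" "degree_one F" "\<And>a. continuous (at_right a) F"
  obtains \<mu> c where "\<mu> \<in> borel_prob_measures" "\<And>t. circle_cdf \<mu> t = F t + c"
proof -
  \<comment> \<open>Clamping the argument freezes \<open>F\<close> outside the period; the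
    subtraction makes the values run from 0 to 1.\<close>
  define K where "K x = F (max (- 1 / 2) (min x (1 / 2))) - F (- 1 / 2)" for x
  have deg: "F (1 / 2) = F (- 1 / 2) + 1"
    using assms(2)[unfolded degree_one_def, rule_format, of "- 1 / 2"] by simp
  have mono: "K x \<le> K y" if "x \<le> y" for x y
    unfolding K_def using that by (intro diff_right_mono monoD[OF assms(1)]) auto
  have rcont: "continuous (at_right a) K" for a
  proof (cases "a < - 1 / 2 \<or> 1 / 2 \<le> a")
    case True
    then have "\<forall>\<^sub>F x in at_right a. K x = K a"
    proof
      assume "a < - 1 / 2"
      then show ?thesis
        unfolding K_def by (intro eventually_at_rightI[of a "- 1 / 2"]) auto
    next
      assume "1 / 2 \<le> a"
      then show ?thesis
        unfolding K_def by (intro eventually_at_rightI[of a "a + 1"]) auto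
    qed
    then show ?thesis
      unfolding continuous_within by (rule tendsto_eventually)
  next
    case False
    then have "\<forall>\<^sub>F x in at_right a. F x - F (- 1 / 2) = K x"
      unfolding K_def by (intro eventually_at_rightI[of a "1 / 2"]) auto
    moreover have "((\<lambda>x. F x - F (- 1 / 2)) \<longlongrightarrow> F a - F (- 1 / 2)) (at_right a)"
      using assms(3)[of a] unfolding continuous_within by (intro tendsto_intros)
    ultimately have "(K \<longlongrightarrow> F a - F (- 1 / 2)) (at_right a)"
      by (rule Lim_transform_eventually[rotated])
    moreover have "K a = F a - F (- 1 / 2)" using False by (simp add: K_def)
    ultimately show ?thesis unfolding continuous_within by simp
  qed
  have bot: "(K \<longlongrightarrow> 0) at_bot"
    by (rule tendsto_eventually)
       (auto simp: K_def eventually_at_bot_linorder intro!: exI[of _ "- 1 / 2"])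
  have top: "(K \<longlongrightarrow> 1) at_top"
    by (rule tendsto_eventually)
       (auto simp: K_def deg eventually_at_top_linorder intro!: exI[of _ "1 / 2"])
  define \<rho> where "\<rho> = interval_measure K"
  interpret \<rho>: real_distribution \<rho>
    unfolding \<rho>_def by (rule real_distribution_interval_measure[OF mono rcont bot top])
  have cdf: "measure \<rho> {..x} = K x" for x
    unfolding \<rho>_def by (rule measure_interval_measure_Iic[OF mono rcont bot])
  have "\<rho>.prob {..- 1 / 2} = 0" "\<rho>.prob {..1 / 2} = 1"
    by (simp_all add: cdf deg K_def)
  \<comment> \<open>\<rho> is concentrated on the range of the coordinate, where
    \<open>circle_coord\<close> inverts \<open>circle_proj\<close>.\<close>
  then have AE: "AE x in \<rho>. - 1 / 2 < x \<and> x \<le> 1 / 2"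
    using \<rho>.prob_eq_0[of "{..- 1 / 2}"] \<rho>.prob_eq_1[of "{..1 / 2}"]
    by (auto simp: not_le)
  define \<mu> where "\<mu> = distr \<rho> circle_borel circle_proj"
  have \<mu>: "\<mu> \<in> borel_prob_measures"
    unfolding \<mu>_def borel_prob_measures_def by (auto intro!: \<rho>.prob_space_distr)
  have "circle_cdf \<mu> t = K t - 1" if t: "- 1 / 2 \<le> t" "t \<le> 1 / 2" for t
  proof -
    have "circle_cdf \<mu> t = (\<integral>x. of_int \<lfloor>t - circle_coord (circle_proj x)\<rfloor> \<partial>\<rho>)"
      unfolding circle_cdf_def \<mu>_def by (rule integral_distr) measurable
    \<comment> \<open>Both \<open>t\<close> and \<open>x\<close> lie in the same period, so the
      floor of \<open>t - x\<close> is 0 or -1 according to whether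
      \<open>x \<le> t\<close>.\<close>
    also have "\<dots> = (\<integral>x. indicator {..t} x - 1 \<partial>\<rho>)"
    proof (rule integral_cong_AE)
      show "AE x in \<rho>. of_int \<lfloor>t - circle_coord (circle_proj x)\<rfloor> = (indicator {..t} x - 1 :: real)"
        using AE
      proof eventually_elim
        case (elim x)
        then have "circle_coord (circle_proj x) = x" by (simp add: circle_coord_proj)
        moreover have "\<lfloor>t - x\<rfloor> = (if x \<le> t then 0 else - 1)"
          using elim t by (auto simp: floor_eq_iff)
        ultimately show ?case by simp
      qed
    qed measurable
    also have "\<dots> = \<rho>.prob {..t} - 1"
      using \<rho>.prob_space by (subst Bochner_Integration.integral_diff) (auto simp: integrable_real_indicator \<rho>.emeasure_eq_measure)
    finally show ?thesis by (simp add: cdf)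
  qed
  then have *: "circle_cdf \<mu> t = F t + (- F (- 1 / 2) - 1)" if "- 1 / 2 \<le> t" "t \<le> 1 / 2" for t
    using that by (simp add: K_def)
  have "circle_cdf \<mu> t - circle_cdf \<mu> (- 1 / 2) = F t - F (- 1 / 2)" for t
    by (rule degree_one_diff_eqI[OF degree_one_circle_cdf[OF \<mu>] assms(2)]) (simp add: *)
  then have "circle_cdf \<mu> t = F t + (- F (- 1 / 2) - 1)" for t
    using *[of "- 1 / 2"] by (simp add: algebra_simps)
  with \<mu> show ?thesis by (rule that)
qed

section \<open>Compactness and cluster points for pointwise convergence\<close>

lemma compact_PiE_real: "compact {F :: 'a \<Rightarrow> real. \<forall>t. a t \<le> F t \<and> F t \<le> b t}"
proof -
  have "compactin (product_topology (\<lambda>_. euclidean) UNIV) (PiE UNIV (\<lambda>t. {a t..b t}))"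
    by (simp add: compactin_PiE)
  moreover have "PiE UNIV (\<lambda>t. {a t..b t}) = {F. \<forall>t. a t \<le> F t \<and> F t \<le> b t}"
    by (auto simp: PiE_iff)
  ultimately show ?thesis
    by (simp add: euclidean_product_topology)
qed

text \<open>Cluster points are phrased with filters because pointwise convergence on the line is not
  first countable. If \<open>F\<close> were outside \<open>S\<close>, the open complement would be a
  neighborhood of \<open>F\<close> that the sequence eventually avoids.\<close>

lemma cluster_point_in_closed:
  assumes "inf (nhds F) (filtermap B sequentially) \<noteq> bot" "closed S" "eventually (\<lambda>n. B n \<in> S) sequentially"
  shows "F \<in> S"
proof (rule ccontr)
  assume "F \<notin> S"
  then have "eventually (\<lambda>x. x \<in> - S) (nhds F)"
    using assms(2) by (intro eventually_nhds_in_open) auto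
  moreover have "eventually (\<lambda>x. x \<in> S) (filtermap B sequentially)"
    using assms(3) by (simp add: eventually_filtermap)
  ultimately have "eventually (\<lambda>x. False) (inf (nhds F) (filtermap B sequentially))"
    unfolding eventually_inf by (intro exI conjI) auto
  then show False using assms(1) by (simp add: trivial_limit_def)
qed

text \<open>Krylov--Bogoliubov averages of the iterates of the identity, with compactness of the
  normalised monotone degree-one functions in the topology of pointwise convergence.\<close>

lemma transfer_op_eigenfunction_exists:
  fixes H :: "'i \<Rightarrow> real \<Rightarrow> real"
  assumes H: "\<And>i. i \<in> I \<Longrightarrow> mono (H i)" "\<And>i. i \<in> I \<Longrightarrow> degree_one (H i)"
    and p: "\<And>i. i \<in> I \<Longrightarrow> 0 \<le> p i" "sum p I = 1"
  obtains F c where "mono F" "degree_one F" "\<And>t. transfer_op I p H F t = F t + c"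
proof -
  let ?T = "transfer_op I p H"
  \<comment> \<open>The identity corresponds, up to a constant, to normalized arc length as the
    starting measure.\<close>
  define L where "L k = (?T ^^ k) (\<lambda>t. t)" for k
  have L: "mono (L k) \<and> degree_one (L k)" for k
  proof (induction k)
    case 0
    show ?case by (simp add: L_def mono_def degree_one_def)
  next
    case (Suc k)
    have "L (Suc k) = ?T (L k)" by (simp add: L_def)
    with Suc show ?case
      using H p by (auto intro!: mono_transfer_op degree_one_transfer_op)
  qed
  \<comment> \<open>Each summand is normalized to vanish at 0, which gives the averages bounds
    independent of \<open>n\<close>.\<close>
  define B where "B n t = (\<Sum>k<Suc n. L k t - L k 0) / Suc n" for n t
  have B_mono: "mono (B n)" for n
    unfolding B_def
    by (intro monoI divide_right_mono sum_mono diff_right_mono) (use L in \<open>auto simp: mono_def\<close>)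
  have B_deg: "B n (t + 1) = B n t + 1" for n t
  proof -
    have "(\<Sum>k<Suc n. L k (t + 1) - L k 0) = (\<Sum>k<Suc n. (L k t - L k 0) + 1)"
      using L by (intro sum.cong) (auto simp: degree_one_def)
    also have "\<dots> = (\<Sum>k<Suc n. L k t - L k 0) + Suc n"
      by (subst sum.distrib) simp
    finally show ?thesis by (simp add: B_def field_simps del: sum.lessThan_Suc)
  qed
  have B0: "B n 0 = 0" for n by (simp add: B_def)
  have B_bounds: "t - 1 \<le> B n t" "B n t \<le> t + 1" for n t
    using mono_degree_one_bounds[OF B_mono[of n], of t] B_deg B0 by (simp_all add: degree_one_def)
  \<comment> \<open>Applying the operator to an average raises the index of each iterate by one, so
    the difference telescopes; subtracting the values at 0 removes the additive drift.\<close>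
  have T_B: "?T (B n) t - B n t - (?T (B n) 0 - B n 0) = 
      ((L (Suc n) t - L (Suc n) 0) - t) / Suc n" for n t
  proof -
    have TB: "?T (B n) s = (\<Sum>k<Suc n. L (Suc k) s - L k 0) / Suc n" for s
    proof -
      have "?T (B n) s = (\<Sum>i\<in>I. \<Sum>k<Suc n. p i * (L k (H i s) - L k 0)) / Suc n"
        unfolding transfer_op_def B_def
        by (simp add: sum_divide_distrib sum_distrib_left del: sum.lessThan_Suc)
      also have "(\<Sum>i\<in>I. \<Sum>k<Suc n. p i * (L k (H i s) - L k 0)) =
          (\<Sum>k<Suc n. \<Sum>i\<in>I. p i * (L k (H i s) - L k 0))"
        by (rule sum.swap)
      also have "\<dots> = (\<Sum>k<Suc n. L (Suc k) s - L k 0)"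
      proof (rule sum.cong)
        fix k
        have "(\<Sum>i\<in>I. p i * (L k (H i s) - L k 0)) = ?T (L k) s - sum p I * L k 0"
          by (simp add: transfer_op_def right_diff_distrib sum_subtractf sum_distrib_right)
        then show "(\<Sum>i\<in>I. p i * (L k (H i s) - L k 0)) = L (Suc k) s - L k 0"
          using p by (simp add: L_def)
      qed simp
      finally show ?thesis .
    qed
    have tele: "(\<Sum>k<Suc n. L (Suc k) s - L k 0) - (\<Sum>k<Suc n. L k s - L k 0) = L (Suc n) s - L 0 s" for s
      unfolding sum_subtractf[symmetric] using sum_lessThan_telescope[of "\<lambda>k. L k s" "Suc n"]
      by (simp del: sum.lessThan_Suc)
    have "?T (B n) s - B n s = (L (Suc n) s - L 0 s) / Suc n" for s
      unfolding TB by (simp add: B_def tele diff_divide_distrib[symmetric] del: sum.lessThan_Suc)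
    then show ?thesis by (simp add: L_def diff_divide_distrib[symmetric])
  qed
  \<comment> \<open>The normalized iterate lies between \<open>t - 1\<close> and
    \<open>t + 1\<close>, so the numerator has absolute value at most 1 for every
    \<open>n\<close>.\<close>
  have T_B_small: "\<bar>?T (B n) t - B n t - (?T (B n) 0 - B n 0)\<bar> \<le> 1 / Suc n" for n t
    unfolding T_B using mono_degree_one_bounds[of "L (Suc n)" t] L[of "Suc n"]
    by (auto simp: abs_le_iff divide_right_mono intro!: divide_right_mono)

  define Q where "Q = {F :: real \<Rightarrow> real. \<forall>t. t - 1 \<le> F t \<and> F t \<le> t + 1}"
  have "compact Q" unfolding Q_def by (rule compact_PiE_real)
  moreover have "eventually (\<lambda>F. F \<in> Q) (filtermap B sequentially)"
    by (simp add: eventually_filtermap Q_def B_bounds)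
  ultimately obtain F where F: "inf (nhds F) (filtermap B sequentially) \<noteq> bot"
    unfolding compact_filter by (metis filtermap_bot_iff trivial_limit_sequentially)
  note limit = cluster_point_in_closed[OF F]
  have "F s \<le> F t" if "s \<le> t" for s t
    using limit[of "{F. F s \<le> F t}"] monoD[OF B_mono that]
    by (simp add: closed_Collect_le continuous_on_product_coordinates)
  then have "mono F" by (rule monoI)
  moreover have "F (t + 1) = F t + 1" for t
    using limit[of "{F. F (t + 1) = F t + 1}"] B_deg
    by (simp add: closed_Collect_eq continuous_on_product_coordinates continuous_on_add)
  then have "degree_one F" by (simp add: degree_one_def)
  moreover have "?T F t - F t - (?T F 0 - F 0) = 0" for t
  proof -
    \<comment> \<open>The defect depends on \<open>F\<close> only through values at fixed points,
      hence is continuous for pointwise convergence. The bound \<open>1 / Suc n\<close> is therefore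
      a closed condition that passes to the cluster point.\<close>
    have cont: "continuous_on UNIV (\<lambda>F. \<bar>?T F t - F t - (?T F 0 - F 0)\<bar>)"
      unfolding transfer_op_def by (intro continuous_intros continuous_on_product_coordinates)
    have "\<bar>?T F t - F t - (?T F 0 - F 0)\<bar> \<le> 1 / Suc n" for n
    proof -
      have "1 / real (Suc m) \<le> 1 / Suc n" if "n \<le> m" for m
        using that by (simp add: frac_le)
      then have "eventually (\<lambda>m. B m \<in> {F. \<bar>?T F t - F t - (?T F 0 - F 0)\<bar> \<le> 1 / Suc n}) sequentially"
        unfolding eventually_sequentially using T_B_small order_trans by blast
      then show ?thesis
        using limit[of "{F. \<bar>?T F t - F t - (?T F 0 - F 0)\<bar> \<le> 1 / Suc n}"] cont
        by (simp add: closed_Collect_le)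
    qed
    then have "\<bar>?T F t - F t - (?T F 0 - F 0)\<bar> \<le> 0"
      by (intro LIMSEQ_le_const[OF LIMSEQ_Suc[OF lim_1_over_n]]) auto
    then show ?thesis by simp
  qed
  then have "?T F t = F t + (?T F 0 - F 0)" for t
    by (simp add: algebra_simps)
  ultimately show ?thesis by (rule that)
qed

section \<open>Right limits\<close>

text \<open>A pointwise cluster point of the averages need not be right-continuous, as a
  distribution function must be. For monotone \<open>F\<close> this infimum is the limit from the
  right.\<close>

definition right_limit :: "(real \<Rightarrow> real) \<Rightarrow> real \<Rightarrow> real" where
  "right_limit F t = Inf (F ` {t<..})"

lemma right_limit_le:
  assumes "mono F" "t < s" shows "right_limit F t \<le> F s"
  unfolding right_limit_def
proof (rule cInf_lower)
  show "bdd_below (F ` {t<..})"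
    by (rule bdd_belowI2[of _ "F t"]) (simp add: assms(1) monoD)
qed (use assms in simp)

lemma le_right_limit:
  assumes "mono F" "s \<le> t" shows "F s \<le> right_limit F t"
  unfolding right_limit_def by (rule cINF_greatest) (use assms in \<open>auto simp: mono_def\<close>)

lemma mono_right_limit:
  assumes "mono F" shows "mono (right_limit F)"
proof (rule monoI)
  fix s t :: real assume "s \<le> t"
  then show "right_limit F s \<le> right_limit F t"
    using le_right_limit[OF assms] right_limit_le[OF assms]
    by (metis order_le_less order_trans order_refl)
qed

lemma tendsto_at_right_right_limit:
  assumes "mono F" shows "(F \<longlongrightarrow> right_limit F t) (at_right t)"
proof (rule order_tendstoI)
  fix a assume a: "a < right_limit F t"
  show "\<forall>\<^sub>F x in at_right t. a < F x"
    by (rule eventually_at_rightI[of t "t + 1"]) (use a right_limit_le[OF assms] in \<open>auto intro: less_le_trans\<close>)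
next
  fix a assume "right_limit F t < a"
  then obtain s where s: "t < s" "F s < a"
    unfolding right_limit_def by (subst (asm) cInf_less_iff)
      (auto intro!: bdd_belowI2[of _ "F t"] monoD[OF assms])
  show "\<forall>\<^sub>F x in at_right t. F x < a"
  proof (rule eventually_at_rightI[of t s])
    fix x assume "x \<in> {t<..<s}"
    then show "F x < a" using monoD[OF assms, of x s] s(2) by simp
  qed (rule s(1))
qed

text \<open>Since \<open>right_limit F x \<le> F y\<close> whenever \<open>x < y\<close>, upper
  estimates for \<open>F\<close> just to the right of \<open>t\<close> pass to
  \<open>right_limit F\<close>; lower ones follow from monotonicity.\<close>

lemma continuous_at_right_right_limit:
  assumes "mono F" shows "continuous (at_right t) (right_limit F)"
  unfolding continuous_within
proof (rule order_tendstoI)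
  fix a assume a: "a < right_limit F t"
  show "\<forall>\<^sub>F x in at_right t. a < right_limit F x"
    by (rule eventually_at_rightI[of t "t + 1"])
       (use a monoD[OF mono_right_limit[OF assms]] in \<open>auto intro: less_le_trans\<close>)
next
  fix a assume "right_limit F t < a"
  then have "\<forall>\<^sub>F x in at_right t. F x < a"
    by (rule order_tendstoD(2)[OF tendsto_at_right_right_limit[OF assms]])
  then obtain b where b: "t < b" "\<And>y. t < y \<Longrightarrow> y < b \<Longrightarrow> F y < a"
    unfolding eventually_at_right_field by blast
  show "\<forall>\<^sub>F x in at_right t. right_limit F x < a"
  proof (rule eventually_at_rightI[of t b])
    fix x assume "x \<in> {t<..<b}"
    then obtain y where "t < x" "x < y" "y < b" using dense by auto
    then show "right_limit F x < a"
      using right_limit_le[OF assms \<open>x < y\<close>] b(2)[of y] by simp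
  qed (rule b(1))
qed

text \<open>A strictly increasing continuous \<open>H i\<close> turns approach to \<open>t\<close>
  from the right into approach to \<open>H i t\<close> from the right, so the equation passes to
  right limits term by term.\<close>

lemma right_limit_transfer_op:
  assumes "mono F" "\<And>i. i \<in> I \<Longrightarrow> strict_mono (H i)" "\<And>i. i \<in> I \<Longrightarrow> continuous_on UNIV (H i)"
    and "\<And>t. transfer_op I p H F t = F t + c"
  shows "transfer_op I p H (right_limit F) t = right_limit F t + c"
proof -
  have "((\<lambda>s. F (H i s)) \<longlongrightarrow> right_limit F (H i t)) (at_right t)" if "i \<in> I" for i
  proof -
    have "(H i \<longlongrightarrow> H i t) (at_right t)"
      using assms(3)[OF that] by (simp add: continuous_on_def) (metis tendsto_within_subset top_greatest)
    moreover have "\<forall>\<^sub>F s in at_right t. H i s \<in> {H i t<..}"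
      by (rule eventually_at_rightI[of t "t + 1"]) (use assms(2)[OF that] in \<open>auto simp: strict_mono_def\<close>)
    ultimately have "filterlim (H i) (at_right (H i t)) (at_right t)"
      by (simp add: filterlim_at eventually_mono)
    from filterlim_compose[OF tendsto_at_right_right_limit[OF assms(1)] this] show ?thesis .
  qed
  then have "((\<lambda>s. transfer_op I p H F s) \<longlongrightarrow> transfer_op I p H (right_limit F) t) (at_right t)"
    unfolding transfer_op_def by (intro tendsto_sum tendsto_mult tendsto_const)
  moreover have "((\<lambda>s. transfer_op I p H F s) \<longlongrightarrow> right_limit F t + c) (at_right t)"
    unfolding assms(4) by (intro tendsto_intros tendsto_at_right_right_limit assms(1))
  ultimately show ?thesis
    by (rule tendsto_unique[rotated]) simp
qed

lemma degree_one_right_limit: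
  assumes "mono F" "degree_one F" shows "degree_one (right_limit F)"
  unfolding degree_one_def
proof
  fix t
  \<comment> \<open>Being of degree one is the equation of the one-element system given by
    translation by 1, with constant 1.\<close>
  have "transfer_op {()} (\<lambda>_. 1) (\<lambda>_ s. s + 1) (right_limit F) t = right_limit F t + 1"
    by (rule right_limit_transfer_op[OF assms(1)])
       (use assms(2) in \<open>auto simp: strict_mono_def transfer_op_def degree_one_def intro!: continuous_intros\<close>)
  then show "right_limit F (t + 1) = right_limit F t + 1"
    by (simp add: transfer_op_def)
qed

section \<open>Minimality\<close>

text \<open>Dividing a point of \<open>S\<close> near the projected midpoint by that projection
  brings it near 1, away from the jump of \<open>Arg\<close>. The tolerance
  \<open>pi * (b - a)\<close> becomes half the interval length after division by
  \<open>2 * pi\<close>.\<close>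

lemma dense_in_circle_lift:
  assumes "circle \<subseteq> closure S" "S \<subseteq> circle" "a < b"
  obtains t where "a < t" "t < b" "circle_proj t \<in> S"
proof -
  define m where "m = (a + b) / 2"
  have "continuous (at 1) Arg" by (rule continuous_at_Arg) simp
  moreover have "0 < pi * (b - a)" using assms(3) by simp
  ultimately obtain d where d: "d > 0" "\<And>u. dist u 1 < d \<Longrightarrow> dist (Arg u) (Arg 1) < pi * (b - a)"
    unfolding continuous_at_eps_delta by blast
  have "circle_proj m \<in> closure S" using assms(1) circle_proj_in_circle by blast
  then obtain w where w: "w \<in> S" "dist w (circle_proj m) < d"
    using d(1) unfolding closure_approachable by blast
  define u where "u = w / circle_proj m"
  define t where "t = m + Arg u / (2 * pi)"
  have m0: "circle_proj m \<noteq> 0" using norm_circle_proj[of m] by fastforce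
  have "norm w = 1" using w(1) assms(2) by auto
  then have u: "norm u = 1" by (simp add: u_def norm_divide)
  then have "u \<noteq> 0" by auto
  then have "circle_proj t = circle_proj m * u"
    using cis_Arg[of u] u by (auto simp: circle_proj_def t_def distrib_left cis_mult[symmetric] sgn_div_norm)
  then have "circle_proj t = w" using m0 by (simp add: u_def)
  moreover have "u - 1 = (w - circle_proj m) / circle_proj m" using m0 by (simp add: u_def field_simps)
  then have "dist u 1 = dist w (circle_proj m)" by (simp add: dist_norm norm_divide)
  then have "\<bar>Arg u\<bar> < pi * (b - a)" using d(2)[of u] w(2) by (simp add: dist_real_def)
  then have "\<bar>t - m\<bar> < (b - a) / 2" by (simp add: t_def abs_mult field_simps)
  then have "a < t" "t < b" unfolding m_def by (simp_all add: abs_less_iff field_simps)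
  ultimately show ?thesis using that w(1) by simp
qed

text \<open>\<open>g\<close> maps the forward orbit of \<open>x\<close> onto that of
  \<open>g x\<close>, and a continuous surjection preserves density.\<close>

lemma dense_forward_orbit_step:
  assumes "homeomorphism circle circle g h" "circle \<subseteq> closure {(g ^^ n) x |n. n \<ge> 1}" "x \<in> circle"
  shows "circle \<subseteq> closure {(g ^^ n) (g x) |n. n \<ge> 1}"
proof -
  let ?S = "{(g ^^ n) x |n. n \<ge> 1}"
  have g: "continuous_on circle g" "g ` circle = circle"
    using assms(1) by (auto simp only: homeomorphism_def)
  have "(g ^^ n) x \<in> circle" for n
    by (induction n) (use g(2) assms(3) in auto)
  then have S: "?S \<subseteq> circle" by blast
  then have "closure ?S \<subseteq> circle" by (simp add: closure_minimal)
  with assms(2) have cl: "closure ?S = circle" by blast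
  have "g ` ?S = {(g ^^ n) (g x) |n. n \<ge> 1}"
  proof -
    have "(g ^^ n) (g x) = g ((g ^^ n) x)" for n by (simp add: funpow_swap1)
    then show ?thesis by (auto simp: image_iff)
  qed
  moreover have "g ` closure ?S \<subseteq> closure (g ` ?S)"
    by (rule image_closure_subset[OF _ closed_closure closure_subset]) (use cl g(1) in simp)
  ultimately show ?thesis using cl g(2) by simp
qed

text \<open>Allows the starting point to be moved along its orbit into a prescribed open
  set.\<close>

lemma dense_forward_orbit_iterate:
  assumes "homeomorphism circle circle g h" "circle \<subseteq> closure {(g ^^ n) x |n. n \<ge> 1}" "x \<in> circle"
  shows "circle \<subseteq> closure {(g ^^ n) ((g ^^ m) x) |n. n \<ge> 1} \<and> (g ^^ m) x \<in> circle"
proof (induction m)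
  case (Suc m)
  then show ?case
    using dense_forward_orbit_step[OF assms(1), of "(g ^^ m) x"] assms(1)
    by (auto simp: homeomorphism_def)
qed (use assms in simp)

text \<open>An orbit returning to a component \<open>I\<close> of the complement of \<open>C\<close> does so through a monotone
  self-map of \<open>I\<close>, so it returns only on one side of its starting point and misses an open set.\<close>

lemma backward_invariant_closed_trivial:
  assumes GH: "real_degree_one_homeo G H" and lift: "\<And>t. g (circle_proj t) = circle_proj (G t)"
    and g: "homeomorphism circle circle g h" and x: "x \<in> circle"
    and dense: "circle \<subseteq> closure {(g ^^ n) x | n. n \<ge> 1}"
    and C: "closed C" "C \<noteq> {}" "\<And>t. t \<in> C \<Longrightarrow> H t \<in> C" "\<And>t k. t \<in> C \<Longrightarrow> t + of_int k \<in> C"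
  shows "C = UNIV"
proof (rule ccontr)
  note GHD = real_degree_one_lift_homeoD[OF GH]
  assume "C \<noteq> UNIV"
  then obtain y0 where "y0 \<in> - C" by blast
  have orbit_x: "{(g ^^ n) x | n. n \<ge> 1} \<subseteq> circle"
    using dense_forward_orbit_iterate[OF g dense x] by blast
  from \<open>y0 \<in> - C\<close> obtain e where e: "e > 0" "ball y0 e \<subseteq> - C"
    using C(1) by (metis open_Compl open_contains_ball)
  \<comment> \<open>Density puts a point of the orbit of \<open>x\<close> into the complement of
    \<open>C\<close>; its own forward orbit is again dense.\<close>
  obtain y where "y0 - e < y" "y < y0 + e" "circle_proj y \<in> {(g ^^ n) x | n. n \<ge> 1}"
    using dense_in_circle_lift[OF dense orbit_x, of "y0 - e" "y0 + e"] e by auto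
  then obtain m where y: "y \<in> - C" "circle_proj y = (g ^^ m) x"
    using e by (auto simp: dist_real_def subset_eq abs_less_iff)
  have dense_y: "circle \<subseteq> closure {(g ^^ n) (circle_proj y) | n. n \<ge> 1}"
    unfolding y(2) using dense_forward_orbit_iterate[OF g dense x] by blast
  have orbit: "(g ^^ n) (circle_proj t) = circle_proj ((G ^^ n) t)" for n t
    by (induction n) (simp_all add: lift)
  \<comment> \<open>These are the lifts of all forward iterates of \<open>g\<close>. Integer shifts
    commute with \<open>G\<close>, so the family is commutative and closed under
    composition.\<close>
  define \<Psi> where "\<Psi> j k t = (G ^^ j) t + of_int k" for j :: nat and k :: int and t :: real
  have Gj: "(G ^^ j) (t + of_int k) = (G ^^ j) t + of_int k" for j t k
    by (induction j) (simp_all add: degree_one_add_int[OF GHD(3)])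
  have \<Psi>_add: "\<Psi> i k (\<Psi> j l t) = \<Psi> (i + j) (k + l) t" for i j k l t
    by (simp add: \<Psi>_def Gj funpow_add)
  have \<Psi>_cont: "continuous_on UNIV (\<Psi> j k)" for j k
  proof -
    have "continuous_on UNIV (G ^^ j)"
      by (induction j) (auto intro!: continuous_on_compose2[OF GHD(7)] simp: comp_def id_def)
    then show ?thesis unfolding \<Psi>_def by (intro continuous_intros)
  qed
  have Gj_mono: "mono (G ^^ j)" for j
    by (induction j) (use GHD(1)[THEN strict_mono_mono] in \<open>auto simp: mono_def id_def\<close>)
  then have \<Psi>_mono: "s \<le> t \<Longrightarrow> \<Psi> j k s \<le> \<Psi> j k t" for j k s t
    by (simp add: \<Psi>_def monoD)
  \<comment> \<open>Contrapositive of the invariance of \<open>C\<close> under \<open>H\<close>, as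
    \<open>H\<close> undoes \<open>G\<close>.\<close>
  have G_compl: "G t \<in> - C" if "t \<in> - C" for t
    using that C(3)[of "G t"] GHD(6) by auto
  have \<Psi>_compl: "\<Psi> j k t \<in> - C" if "t \<in> - C" for j k t
  proof -
    have "(G ^^ j) t \<in> - C" by (induction j) (use that G_compl in auto)
    then show ?thesis using C(4)[of "\<Psi> j k t" "- k"] by (auto simp: \<Psi>_def)
  qed

  define I where "I = connected_component_set (- C) y"
  have I: "y \<in> I" "I \<subseteq> - C" "connected I" "open I"
    using y C(1) unfolding I_def
    by (simp_all add: connected_component_refl connected_component_subset open_connected_component open_Compl)
  \<comment> \<open>Once one point of \<open>I\<close> returns to \<open>I\<close>, the connected
    image of \<open>I\<close>, which avoids \<open>C\<close>, must stay in the same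
    component.\<close>
  have \<Psi>_I: "\<Psi> j k ` I \<subseteq> I" if "s \<in> I" "\<Psi> j k s \<in> I" for j k s
  proof -
    have "connected_component_set (- C) (\<Psi> j k s) = I"
      using that(2) unfolding I_def by (simp add: connected_component_eq)
    moreover have "\<Psi> j k ` I \<subseteq> connected_component_set (- C) (\<Psi> j k s)"
      by (rule connected_component_maximal)
         (use that I \<Psi>_compl continuous_on_subset[OF \<Psi>_cont] in \<open>auto intro: connected_continuous_image\<close>)
    ultimately show ?thesis by simp
  qed
  \<comment> \<open>An interval containing a full period would meet the periodic set
    \<open>C\<close>. Hence a point and a nontrivial integer translate of it cannot both lie in
    \<open>I\<close>.\<close>
  have I_short: "\<bar>s - t\<bar> < 1" if st: "s \<in> I" "t \<in> I" for s t
  proof (rule ccontr)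
    assume "\<not> \<bar>s - t\<bar> < 1"
    obtain c where c: "c \<in> C" using C(2) by blast
    define a where "a = min s t"
    have sub: "{a..a + 1} \<subseteq> I"
    proof
      fix u assume u: "u \<in> {a..a + 1}"
      have "a \<in> I" "max s t \<in> I" "a \<le> u" "u \<le> max s t"
        using st u \<open>\<not> \<bar>s - t\<bar> < 1\<close> by (auto simp: a_def min_def max_def abs_if split: if_splits)
      then show "u \<in> I"
        using I(3) by (meson connectedD_interval)
    qed
    have "c + of_int (\<lceil>a - c\<rceil>) \<in> {a..a + 1}" by auto linarith+
    then show False using sub I(2) C(4)[OF c] by blast
  qed
  define R where "R = {j. j \<ge> 1 \<and> (\<exists>k. \<Psi> j k y \<in> I)}"
  have dense_\<Psi>: "\<exists>j k. j \<ge> 1 \<and> \<Psi> j k y \<in> {a<..<b}" if ab: "a < b" for a b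
  proof -
    have orbit_y: "{(g ^^ n) (circle_proj y) | n. n \<ge> 1} \<subseteq> circle"
      by (auto simp: orbit)
    obtain t where t: "a < t" "t < b" "circle_proj t \<in> {(g ^^ n) (circle_proj y) | n. n \<ge> 1}"
      by (rule dense_in_circle_lift[OF dense_y orbit_y ab])
    then obtain n where n: "n \<ge> 1" "circle_proj t = circle_proj ((G ^^ n) y)" by (auto simp: orbit)
    then obtain k :: int where "t = \<Psi> n k y" unfolding circle_proj_eq_iff \<Psi>_def by blast
    with n t show ?thesis by auto
  qed
  obtain d where d: "d > 0" "{y - d<..<y + d} \<subseteq> I"
    using I(1,4) by (metis ball_eq_greaterThanLessThan open_contains_ball)
  have "y - d < y + d" using d(1) by simp
  then obtain j\<^sub>0 k\<^sub>0 where "j\<^sub>0 \<ge> 1" "\<Psi> j\<^sub>0 k\<^sub>0 y \<in> {y - d<..<y + d}"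
    using dense_\<Psi> by metis
  then have "j\<^sub>0 \<in> R" using d(2) unfolding R_def by blast
  then have "R \<noteq> {}" by blast
  \<comment> \<open>The first return time of \<open>y\<close> to \<open>I\<close>, over all integer
    shifts.\<close>
  define n where "n = (LEAST j. j \<in> R)"
  have "n \<in> R" unfolding n_def using \<open>R \<noteq> {}\<close> by (metis LeastI ex_in_conv)
  then obtain k where k: "\<Psi> n k y \<in> I" and "n \<ge> 1" unfolding R_def by auto
  \<comment> \<open>Every return factors through the first. The map
    \<open>\<Psi> (j - n) (l - k)\<close> takes \<open>\<Psi> n k y\<close> to
    \<open>\<Psi> j l y\<close>, both in \<open>I\<close>, so it maps \<open>I\<close> into itself;
    hence it also returns \<open>y\<close> to \<open>I\<close>, and it commutes with
    \<open>\<Psi> n k\<close>.\<close>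
  have step: "j \<ge> n \<and> \<Psi> (j - n) (l - k) y \<in> I \<and> \<Psi> j l y = \<Psi> n k (\<Psi> (j - n) (l - k) y)"
    if "j \<ge> 1" "\<Psi> j l y \<in> I" for j l
  proof -
    have "j \<in> R" using that by (auto simp: R_def)
    then have "n \<le> j" unfolding n_def by (rule Least_le)
    then have "\<Psi> (j - n) (l - k) (\<Psi> n k y) = \<Psi> j l y" "\<Psi> n k (\<Psi> (j - n) (l - k) y) = \<Psi> j l y"
      by (simp_all add: \<Psi>_add)
    moreover from this have "\<Psi> (j - n) (l - k) ` I \<subseteq> I"
      using \<Psi>_I[of "\<Psi> n k y" "j - n" "l - k"] k that by simp
    ultimately show ?thesis using \<open>n \<le> j\<close> I(1) by auto
  qed
  have zero: "\<Psi> 0 l y = y" if "\<Psi> 0 l y \<in> I" for l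
    using I_short[OF that I(1)] by (simp add: \<Psi>_def)
  show False
  proof (cases "y \<le> \<Psi> n k y")
    case True
    \<comment> \<open>If the first return does not move \<open>y\<close> to the left, monotonicity
      of \<open>\<Psi> n k\<close> propagates this to all returns, against density just to the left
      of \<open>y\<close>.\<close>
    have "\<Psi> j l y \<in> I \<longrightarrow> y \<le> \<Psi> j l y" for j l
    proof (induction j arbitrary: l rule: less_induct)
      case (less j)
      show ?case
      proof (cases "j = 0")
        case False
        show ?thesis
        proof
          assume "\<Psi> j l y \<in> I"
          from step[OF _ this] False have *: "n \<le> j" "\<Psi> (j - n) (l - k) y \<in> I"
            "\<Psi> j l y = \<Psi> n k (\<Psi> (j - n) (l - k) y)" by auto
          then have "y \<le> \<Psi> (j - n) (l - k) y" using less \<open>n \<ge> 1\<close> by simp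
          then show "y \<le> \<Psi> j l y" using True \<Psi>_mono *(3) order_trans by metis
        qed
      qed (use zero[of l] in auto)
    qed
    moreover obtain j l where "\<Psi> j l y \<in> {y - d<..<y}"
      using dense_\<Psi>[of "y - d" y] d(1) by auto
    moreover from this have "\<Psi> j l y \<in> I" using d by (intro subsetD[OF d(2)]) auto
    ultimately show False by (meson greaterThanLessThan_iff not_le)
  next
    case False
    \<comment> \<open>Mirror image, contradicting density just to the right of
      \<open>y\<close>.\<close>
    have "\<Psi> j l y \<in> I \<longrightarrow> \<Psi> j l y \<le> y" for j l
    proof (induction j arbitrary: l rule: less_induct)
      case (less j)
      show ?case
      proof (cases "j = 0")
        case nz: False
        show ?thesis
        proof
          assume "\<Psi> j l y \<in> I"
          from step[OF _ this] nz have *: "n \<le> j" "\<Psi> (j - n) (l - k) y \<in> I"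
            "\<Psi> j l y = \<Psi> n k (\<Psi> (j - n) (l - k) y)" by auto
          then have "\<Psi> (j - n) (l - k) y \<le> y" using less \<open>n \<ge> 1\<close> by simp
          then show "\<Psi> j l y \<le> y" using False \<Psi>_mono *(3) order_trans by (metis nle_le)
        qed
      qed (use zero[of l] in auto)
    qed
    moreover obtain j l where "\<Psi> j l y \<in> {y<..<y + d}"
      using dense_\<Psi>[of y "y + d"] d(1) by auto
    moreover from this have "\<Psi> j l y \<in> I" using d by (intro subsetD[OF d(2)]) auto
    ultimately show False by (meson greaterThanLessThan_iff not_le)
  qed
qed

section \<open>Uniqueness\<close>

text \<open>The deficits \<open>M - x i\<close> are nonnegative with weighted sum at most 0, so each
  weighted deficit vanishes, and \<open>p j > 0\<close> can be cancelled.\<close>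

lemma weighted_mean_eq_upper_bound:
  fixes x :: "'i \<Rightarrow> real"
  assumes "finite I" "\<And>i. i \<in> I \<Longrightarrow> 0 < p i" "sum p I = 1" "\<And>i. i \<in> I \<Longrightarrow> x i \<le> M"
    and "M \<le> (\<Sum>i\<in>I. p i * x i)" "j \<in> I"
  shows "x j = M"
proof -
  have "(\<Sum>i\<in>I. p i * (M - x i)) = sum p I * M - (\<Sum>i\<in>I. p i * x i)"
    by (simp add: right_diff_distrib sum_subtractf sum_distrib_right)
  also have "\<dots> \<le> 0" using assms by simp
  finally have "(\<Sum>i\<in>I. p i * (M - x i)) = 0"
    using assms by (intro antisym sum_nonneg mult_nonneg_nonneg) (auto simp: less_imp_le)
  then have "p j * (M - x j) = 0"
    using assms by (subst (asm) sum_nonneg_eq_0_iff) (auto simp: less_imp_le)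
  then show ?thesis using assms(2)[OF assms(6)] by simp
qed

section \<open>Atoms and continuity of lifted distribution functions\<close>

lemma infinite_circle: "infinite circle"
proof
  assume "finite circle"
  then have "finite (circle_proj ` {0<..<1 / 2})"
    by (rule finite_subset[rotated]) auto
  moreover have "inj_on circle_proj {0<..<1 / 2}"
    by (rule inj_on_inverseI[where g = circle_coord]) (auto intro: circle_coord_proj)
  ultimately have "finite {0<..<1 / 2 :: real}" by (rule finite_imageD)
  then show False by (simp add: infinite_Ioo)
qed

text \<open>The masses of a finite set of such points add up to at most 1, which bounds its
  cardinality by \<open>1 / e\<close>.\<close>

lemma (in prob_space) finite_large_atoms:
  assumes "e > 0" "\<And>z. z \<in> A \<Longrightarrow> {z} \<in> events" "\<And>z. z \<in> A \<Longrightarrow> e \<le> prob {z}"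
  shows "finite A"
proof (rule finite_if_finite_subsets_card_bdd[THEN conjunct1])
  fix B assume B: "B \<subseteq> A" "finite B"
  have "of_nat (card B) * e \<le> (\<Sum>z\<in>B. prob {z})"
    by (rule sum_bounded_below) (use B assms(3) in auto)
  also have "\<dots> = prob B"
    using B assms(2) by (subst finite_measure_eq_sum_singleton) auto
  also have "\<dots> \<le> 1" by (rule prob_le_1)
  finally have "of_nat (card B) \<le> 1 / e" using assms(1) by (simp add: field_simps)
  then show "card B \<le> nat \<lfloor>1 / e\<rfloor>" by linarith
qed

text \<open>Dominated convergence: the integrand is discontinuous in its parameter at
  \<open>t\<close> only for \<open>z = circle_proj t\<close>, a null set.\<close>

lemma continuous_circle_cdf:
  assumes \<mu>: "\<mu> \<in> borel_prob_measures" and "\<And>t. measure \<mu> {circle_proj t} = 0"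
  shows "continuous_on UNIV (circle_cdf \<mu>)"
proof -
  interpret prob_space \<mu> by (rule borel_prob_measuresD[OF \<mu>])
  have "isCont (circle_cdf \<mu>) t" for t
    unfolding continuous_at_sequentially comp_def
  proof (intro allI impI)
    fix X assume X: "X \<longlonglongrightarrow> t"
    then obtain K where K: "\<And>n. \<bar>X n\<bar> \<le> K"
      by (metis BseqE convergentI convergent_imp_Bseq real_norm_def)
    show "(\<lambda>n. circle_cdf \<mu> (X n)) \<longlonglongrightarrow> circle_cdf \<mu> t"
      unfolding circle_cdf_def
    proof (rule integral_dominated_convergence[where w = "\<lambda>_. K + 2"])
      have "{circle_proj t} \<in> sets circle_borel"
        by (auto simp: circle_borel_def sets_restrict_space_iff)
      then have "AE z in \<mu>. z \<notin> {circle_proj t}"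
        using assms(2)[of t] prob_eq_0[of "{circle_proj t}"] borel_prob_measuresD(2)[OF \<mu>] by simp
      then show "AE z in \<mu>. (\<lambda>n. of_int \<lfloor>X n - circle_coord z\<rfloor> :: real) \<longlonglongrightarrow> of_int \<lfloor>t - circle_coord z\<rfloor>"
        using AE_space
      proof eventually_elim
        case (elim z)
        then have z: "z \<in> circle" using borel_prob_measuresD(3)[OF \<mu>] by simp
        have "t - circle_coord z \<notin> \<int>"
        proof
          assume "t - circle_coord z \<in> \<int>"
          then obtain k :: int where "t = circle_coord z + of_int k"
            by (metis Ints_cases add.commute diff_add_cancel)
          then have "circle_proj t = z" using z by simp
          then show False using elim by simp
        qed
        moreover have "(\<lambda>n. X n - circle_coord z) \<longlonglongrightarrow> t - circle_coord z"
          by (intro tendsto_intros X)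
        ultimately show ?case by (intro tendsto_of_int_floor)
      qed
      show "AE z in \<mu>. norm (of_int \<lfloor>X n - circle_coord z\<rfloor> :: real) \<le> K + 2" for n
        by (rule AE_I2) (use order_trans[OF abs_floor_minus_coord_le[of "X n"], of "K + 2"] K[of n] in simp)
      show "(\<lambda>z. of_int \<lfloor>t - circle_coord z\<rfloor> :: real) \<in> borel_measurable \<mu>"
        by (rule borel_measurable_integrable[OF integrable_floor_minus_coord[OF \<mu>]])
      show "(\<lambda>z. of_int \<lfloor>X n - circle_coord z\<rfloor> :: real) \<in> borel_measurable \<mu>" for n
        by (rule borel_measurable_integrable[OF integrable_floor_minus_coord[OF \<mu>]])
    qed simp
  qed
  then show ?thesis by (simp add: continuous_at_imp_continuous_on)
qed

section \<open>Invariant measures when one element is minimal\<close>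

context
  fixes \<Gamma> :: "(complex \<Rightarrow> complex) set" and p :: "(complex \<Rightarrow> complex) \<Rightarrow> real"
    and G H g\<^sub>1
  assumes fin: "finite \<Gamma>" and sub: "\<Gamma> \<subseteq> Hplus"
    and pos: "\<And>g. g \<in> \<Gamma> \<Longrightarrow> 0 < p g" and sum1: "sum p \<Gamma> = 1"
    and homeo: "\<And>g. g \<in> \<Gamma> \<Longrightarrow> real_degree_one_homeo (G g) (H g)"
    and lift: "\<And>g t. g \<in> \<Gamma> \<Longrightarrow> g (circle_proj t) = circle_proj (G g t)"
    and g1: "g\<^sub>1 \<in> \<Gamma>"
    and minimal: "\<And>C. closed C \<Longrightarrow> C \<noteq> {} \<Longrightarrow> (\<And>t. t \<in> C \<Longrightarrow> H g\<^sub>1 t \<in> C) \<Longrightarrow>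
      (\<And>t k. t \<in> C \<Longrightarrow> t + of_int k \<in> C) \<Longrightarrow> C = UNIV"
begin

lemma weights_nonneg: "g \<in> \<Gamma> \<Longrightarrow> 0 \<le> p g"
  using pos by (simp add: less_imp_le)

lemmas lift_homeoD = real_degree_one_lift_homeoD[OF homeo]

text \<open>At a maximum, all positively weighted values \<open>D (H g t)\<close> must be maximal,
  so the level set is invariant under \<open>H g\<^sub>1\<close> and \<open>minimal\<close> applies.
  Closedness is asked of the level set rather than continuity of \<open>D\<close>, to cover atom
  masses.\<close>

lemma maximum_principle:
  assumes "closed {t. D t = M}" "\<And>t. D t \<le> M" "D s = M" "\<And>t (k :: int). D (t + of_int k) = D t"
    and "\<And>t. transfer_op \<Gamma> p H D t = D t"
  shows "D t = M"
proof -
  have "{t. D t = M} = UNIV"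
  proof (rule minimal)
    fix t assume "t \<in> {t. D t = M}"
    then have "M \<le> (\<Sum>g\<in>\<Gamma>. p g * D (H g t))"
      using assms(5)[of t] by (simp add: transfer_op_def)
    then have "D (H g\<^sub>1 t) = M"
      using weighted_mean_eq_upper_bound[of \<Gamma> p "\<lambda>g. D (H g t)" M g\<^sub>1] fin pos sum1 assms(2) g1 by simp
    then show "H g\<^sub>1 t \<in> {t. D t = M}" by simp
  qed (use assms in auto)
  then show ?thesis by auto
qed

text \<open>Point masses satisfy the transfer equation and attain their maximum, because only
  finitely many are large. The maximum principle would spread a positive maximal mass over the
  infinite circle.\<close>

lemma invariant_measure_no_atoms:
  assumes \<mu>: "\<mu> \<in> borel_prob_measures" and inv: "invariant_measure \<Gamma> p \<mu>"
  shows "measure \<mu> {circle_proj t} = 0"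
proof (rule ccontr)
  assume nz: "measure \<mu> {circle_proj t} \<noteq> 0"
  interpret prob_space \<mu> by (rule borel_prob_measuresD[OF \<mu>])
  have sing: "{z} \<in> sets circle_borel" if "z \<in> circle" for z
    using that by (auto simp: circle_borel_def sets_restrict_space_iff)
  define a where "a s = measure \<mu> {circle_proj s}" for s
  \<comment> \<open>The points at least as heavy as the assumed atom: a finite set, so the maximum
    over it is attained and is a global maximum.\<close>
  define A where "A = {z \<in> circle. a t \<le> measure \<mu> {z}}"
  have "a t > 0" using nz by (simp add: a_def zero_less_measure_iff)
  then have "finite A"
    by (rule finite_large_atoms) (use sing borel_prob_measuresD(2)[OF \<mu>] in \<open>auto simp: A_def\<close>)
  moreover have tA: "circle_proj t \<in> A" by (simp add: A_def a_def)
  define M where "M = Max ((\<lambda>z. measure \<mu> {z}) ` A)"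
  have "M \<in> (\<lambda>z. measure \<mu> {z}) ` A"
    unfolding M_def using \<open>finite A\<close> tA by (intro Max_in) auto
  then obtain z where z: "z \<in> circle" "measure \<mu> {z} = M" "a t \<le> M" by (auto simp: A_def)
  have le: "a s \<le> M" for s
  proof (cases "a t \<le> a s")
    case True
    then have "circle_proj s \<in> A" by (simp add: A_def a_def)
    then show ?thesis unfolding M_def a_def using \<open>finite A\<close> by (intro Max_ge) auto
  qed (use z in simp)
  have "a s = M" for s
  proof (rule maximum_principle[where D = a and s = "circle_coord z"])
    \<comment> \<open>The level set is the preimage of a finite set, hence closed although
      \<open>a\<close> need not be continuous.\<close>
    have "{s. a s = M} = circle_proj -` {z \<in> A. measure \<mu> {z} = M}"
      using z(3) by (auto simp: a_def A_def)
    moreover have "closed {z \<in> A. measure \<mu> {z} = M}"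
      using \<open>finite A\<close> by (intro finite_imp_closed) simp
    ultimately show "closed {s. a s = M}"
      by (simp only: closed_vimage continuous_on_circle_proj)
    show "a (circle_coord z) = M" using z by (simp add: a_def)
    show "transfer_op \<Gamma> p H a s = a s" for s
    proof -
      have "a s = measure (markov_op \<Gamma> p \<mu>) {circle_proj s}"
        using inv by (simp add: a_def invariant_measure_def)
      also have "\<dots> = (\<Sum>g\<in>\<Gamma>. p g * measure \<mu> (g -` {circle_proj s} \<inter> circle))"
        by (rule measure_markov_op[OF sub weights_nonneg sum1 \<mu> sing]) auto
      also have "\<dots> = transfer_op \<Gamma> p H a s"
        unfolding transfer_op_def
      proof (intro sum.cong arg_cong2[where f = "(*)"] refl)
        fix g assume g: "g \<in> \<Gamma>"
        have "g -` {circle_proj s} \<inter> circle = {circle_proj (H g s)}"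
        proof (intro set_eqI iffI)
          fix z assume "z \<in> g -` {circle_proj s} \<inter> circle"
          then obtain x where x: "z = circle_proj x" "circle_proj s = circle_proj (G g x)"
            unfolding circle_eq_range_proj using lift[OF g] by auto
          then obtain k :: int where "s = G g x + of_int k" unfolding circle_proj_eq_iff by blast
          then have "H g s = x + of_int k"
            using lift_homeoD(6)[OF g] degree_one_add_int[OF lift_homeoD(4)[OF g]] by simp
          then show "z \<in> {circle_proj (H g s)}" by (simp add: x)
        qed (use lift[OF g] lift_homeoD(5)[OF g] in auto)
        then show "measure \<mu> (g -` {circle_proj s} \<inter> circle) = a (H g s)"
          by (simp add: a_def)
      qed
      finally show ?thesis ..
    qed
  qed (use le in \<open>auto simp: a_def\<close>)
  then have "measure \<mu> {z} = M" if "z \<in> circle" for z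
    using that unfolding a_def circle_eq_range_proj by auto
  then have "circle \<subseteq> A" using z(3) by (auto simp: A_def)
  then show False using \<open>finite A\<close> infinite_circle finite_subset by blast
qed

lemma continuous_periodic_eigenfunction_const:
  assumes cont: "continuous_on UNIV D" and per: "\<And>t (k :: int). D (t + of_int k) = D t"
    and T: "\<And>t. transfer_op \<Gamma> p H D t = D t + c"
  shows "D t = D s"
proof -
  have cont01: "continuous_on {0..1} D" using cont by (rule continuous_on_subset) simp
  have D_frac: "D u = D (frac u)" and frac: "frac u \<in> {0..1}" for u
    using per[of "frac u" "\<lfloor>u\<rfloor>"] by (simp_all add: frac_def less_imp_le[OF frac_lt_1, unfolded frac_def])
  obtain a where "\<forall>u\<in>{0..1}. D u \<le> D a"
    using continuous_attains_sup[OF compact_Icc _ cont01] by auto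
  moreover obtain b where "\<forall>u\<in>{0..1}. D b \<le> D u"
    using continuous_attains_inf[OF compact_Icc _ cont01] by auto
  ultimately have ab: "D u \<le> D a" "D b \<le> D u" for u
    using frac[of u] by (simp_all only: D_frac[of u])
  have mean: "transfer_op \<Gamma> p H (\<lambda>_. r) u = r" for r u
    using sum1 by (simp add: transfer_op_def sum_distrib_right[symmetric])
  \<comment> \<open>The maximum point \<open>a\<close> yields \<open>c \<le> 0\<close>, the minimum
    point \<open>b\<close> yields \<open>c \<ge> 0\<close>.\<close>
  have "transfer_op \<Gamma> p H D a \<le> transfer_op \<Gamma> p H (\<lambda>_. D a) a"
    "transfer_op \<Gamma> p H (\<lambda>_. D b) b \<le> transfer_op \<Gamma> p H D b"
    unfolding transfer_op_def by (intro sum_mono mult_left_mono weights_nonneg ab; assumption)+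
  then have "c = 0" by (simp add: T mean)
  have "closed {t. D t = D a}" using cont by (intro closed_Collect_eq continuous_on_const)
  then have "D u = D a" for u
    by (rule maximum_principle[where s = a]) (use ab per T \<open>c = 0\<close> in auto)
  then show ?thesis by metis
qed

lemma invariant_measure_unique:
  assumes \<mu>: "\<mu> \<in> borel_prob_measures" "invariant_measure \<Gamma> p \<mu>"
    and \<nu>: "\<nu> \<in> borel_prob_measures" "invariant_measure \<Gamma> p \<nu>"
  shows "\<mu> = \<nu>"
proof -
  define D where "D t = circle_cdf \<mu> t - circle_cdf \<nu> t" for t
  note iff = invariant_measure_iff_transfer_op[OF sub weights_nonneg sum1 _ homeo lift]
  obtain c d where "\<And>t. transfer_op \<Gamma> p H (circle_cdf \<mu>) t = circle_cdf \<mu> t + c"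
    "\<And>t. transfer_op \<Gamma> p H (circle_cdf \<nu>) t = circle_cdf \<nu> t + d"
    using iff[OF _ \<mu>(1)] iff[OF _ \<nu>(1)] \<mu>(2) \<nu>(2) by metis
  then have "transfer_op \<Gamma> p H D t = D t + (c - d)" for t
    by (simp add: transfer_op_def D_def right_diff_distrib sum_subtractf)
  note eigen = this
  have "continuous_on UNIV D"
    unfolding D_def
    by (intro continuous_on_diff continuous_circle_cdf invariant_measure_no_atoms \<mu> \<nu>)
  moreover have "D (t + of_int k) = D t" for t k
    using degree_one_add_int[OF degree_one_circle_cdf] \<mu>(1) \<nu>(1) by (simp add: D_def)
  ultimately have "D t = D 0" for t
    by (rule continuous_periodic_eigenfunction_const[OF _ _ eigen])
  then have "circle_cdf \<mu> t = circle_cdf \<nu> t + D 0" for t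
    by (simp add: D_def algebra_simps)
  then show ?thesis by (rule circle_cdf_inject[OF \<mu>(1) \<nu>(1)])
qed

text \<open>The eigenfunction is only known to be monotone of degree one; right limits keep the
  equation and supply the right continuity that lets a measure represent it.\<close>

lemma invariant_measure_exists:
  obtains \<mu> where "\<mu> \<in> borel_prob_measures" "invariant_measure \<Gamma> p \<mu>"
proof -
  obtain F c where F: "mono F" "degree_one F" "\<And>t. transfer_op \<Gamma> p H F t = F t + c"
    by (rule transfer_op_eigenfunction_exists[of \<Gamma> H p])
       (auto intro: weights_nonneg sum1 lift_homeoD(4) strict_mono_mono[OF lift_homeoD(2)])
  obtain \<mu> d where \<mu>: "\<mu> \<in> borel_prob_measures" "\<And>t. circle_cdf \<mu> t = right_limit F t + d"
    by (rule prob_measure_of_circle_cdf[OF mono_right_limit[OF F(1)] degree_one_right_limit[OF F(1,2)]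
      continuous_at_right_right_limit[OF F(1)]]) (rule that)
  have "transfer_op \<Gamma> p H (right_limit F) t = right_limit F t + c" for t
    by (rule right_limit_transfer_op[OF F(1) _ _ F(3)]) (use lift_homeoD in auto)
  then have "transfer_op \<Gamma> p H (circle_cdf \<mu>) t = circle_cdf \<mu> t + c" for t
    using sum1 by (simp add: transfer_op_def \<mu>(2)[abs_def] distrib_left sum.distrib sum_distrib_right[symmetric])
  then have "invariant_measure \<Gamma> p \<mu>"
    by (subst invariant_measure_iff_transfer_op[OF sub weights_nonneg sum1 \<mu>(1) homeo lift]) blast+
  with \<mu>(1) show ?thesis by (rule that)
qed

end

theorem proposition1:
  fixes \<Gamma> :: "(complex \<Rightarrow> complex) set"
    and p :: "(complex \<Rightarrow> complex) \<Rightarrow> real"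
  assumes "finite \<Gamma>" and "\<Gamma> \<subseteq> Hplus"
    and "admissible \<Gamma>"
    and "\<forall>g\<in>\<Gamma>. p g > 0" and "(\<Sum>g\<in>\<Gamma>. p g) = 1"
  shows "\<exists>!\<mu>. \<mu> \<in> borel_prob_measures \<and> invariant_measure \<Gamma> p \<mu>"
proof -
  have "\<forall>g\<in>\<Gamma>. \<exists>G H. real_degree_one_homeo G H \<and> (\<forall>t. g (circle_proj t) = circle_proj (G t))"
    using assms(2) Hplus_lift by (metis subsetD)
  then obtain G H where homeo: "\<And>g. g \<in> \<Gamma> \<Longrightarrow> real_degree_one_homeo (G g) (H g)"
    and lift: "\<And>g t. g \<in> \<Gamma> \<Longrightarrow> g (circle_proj t) = circle_proj (G g t)"
    by metis
  obtain g x where g: "g \<in> \<Gamma>" and x: "x \<in> circle" "circle \<subseteq> closure {(g ^^ n) x | n. n \<ge> 1}"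
    using assms(3) unfolding admissible_def by blast
  obtain h where h: "homeomorphism circle circle g h"
    using g assms(2) unfolding Hplus_def by blast
  have pos: "\<And>g. g \<in> \<Gamma> \<Longrightarrow> 0 < p g" using assms(4) by blast
  note minimal = backward_invariant_closed_trivial[OF homeo[OF g] lift[OF g] h x]
  obtain \<mu> where "\<mu> \<in> borel_prob_measures" "invariant_measure \<Gamma> p \<mu>"
    by (rule invariant_measure_exists[OF assms(1,2) pos assms(5) homeo lift g minimal])
  moreover have "\<nu> = \<mu>" if "\<nu> \<in> borel_prob_measures" "invariant_measure \<Gamma> p \<nu>" for \<nu>
    by (rule invariant_measure_unique[OF assms(1,2) pos assms(5) homeo lift g minimal that calculation])
  ultimately show ?thesis by blast
qed

end
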